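(* Any multiverse $\mathcal M$ satisfying the Wellfoundedness Mirage axiom consists entirely of computably saturated models of $\mathrm{ZFC}$.
   Context: A \emph{multiverse} is a nonempty set or class of models of $\mathrm{ZFC}$. A multiverse $\mathcal M$ satisfies the \emph{Wellfoundedness Mirage} axiom if for every $M\in\mathcal M$ there is $N\in\mathcal M$ which thinks $M$ is a set with an ill-founded $\omega$. When it is said that a model $M$ is an element of (or a set in) another model $N$, what is meant is that there is an object in $N$ that $N$ thinks is a pair $\langle m,E\rangle$ with $E$ a binary relation on $m$, and externally the set $\{a\in N\mid N\models a\in m\}$ with the relation $\{(a,b)\mid N\models a\mathrel{E}b\}$ is isomorphic to $M$ with its membership relation. It is not required that $N$ regard $M$ as a model of $\mathrm{ZFC}$. A model $M$ of a computable language is \emph{computably saturated} if for every finite tuple $\bar a$ in $M$, every finitely realizable computable type $p(\bar a,\bar x)$ is already realized in $M$; a type $p(\bar y,\bar x)$ is computable if the set of Gödel codes of its formulas is computable. *)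

theory Defs
  imports Main "HOL-Library.Nat_Bijection"
begin

section \<open>Structures and formulas in the language of set theory\<close>

record 'a struct =
  dom :: "'a set"
  rel :: "('a \<times> 'a) set"

definition is_struct :: "'a struct \<Rightarrow> bool" where
  "is_struct M \<longleftrightarrow> dom M \<noteq> {} \<and> rel M \<subseteq> dom M \<times> dom M"

abbreviation mem :: "'a struct \<Rightarrow> 'a \<Rightarrow> 'a \<Rightarrow> bool" where
  "mem M x y \<equiv> (x, y) \<in> rel M"

definition isomorphic :: "'a struct \<Rightarrow> 'b struct \<Rightarrow> bool" where
  "isomorphic A B \<longleftrightarrow>
     (\<exists>f. bij_betw f (dom A) (dom B) \<and>
          (\<forall>x\<in>dom A. \<forall>y\<in>dom A. mem A x y \<longleftrightarrow> mem B (f x) (f y)))"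

datatype fm =
    Eq nat nat
  | Mem nat nat
  | Neg fm
  | Conj fm fm
  | All nat fm

fun sat :: "'a struct \<Rightarrow> (nat \<Rightarrow> 'a) \<Rightarrow> fm \<Rightarrow> bool" where
  "sat M s (Eq i j) \<longleftrightarrow> s i = s j"
| "sat M s (Mem i j) \<longleftrightarrow> mem M (s i) (s j)"
| "sat M s (Neg \<phi>) \<longleftrightarrow> \<not> sat M s \<phi>"
| "sat M s (Conj \<phi> \<psi>) \<longleftrightarrow> sat M s \<phi> \<and> sat M s \<psi>"
| "sat M s (All i \<phi>) \<longleftrightarrow> (\<forall>x\<in>dom M. sat M (s(i := x)) \<phi>)"

fun fv :: "fm \<Rightarrow> nat set" where
  "fv (Eq i j) = {i, j}"
| "fv (Mem i j) = {i, j}"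
| "fv (Neg \<phi>) = fv \<phi>"
| "fv (Conj \<phi> \<psi>) = fv \<phi> \<union> fv \<psi>"
| "fv (All i \<phi>) = fv \<phi> - {i}"

fun godel :: "fm \<Rightarrow> nat" where
  "godel (Eq i j) = prod_encode (0, prod_encode (i, j))"
| "godel (Mem i j) = prod_encode (1, prod_encode (i, j))"
| "godel (Neg \<phi>) = prod_encode (2, godel \<phi>)"
| "godel (Conj \<phi> \<psi>) = prod_encode (3, prod_encode (godel \<phi>, godel \<psi>))"
| "godel (All i \<phi>) = prod_encode (4, prod_encode (i, godel \<phi>))"

section \<open>Models of ZFC\<close>

text \<open>
  Each axiom is written as its satisfaction condition in a structure, that is, with all
  quantifiers ranging over the domain and membership read as the relation of the structure.
  In the two schemes, an assignment into the domain supplies the parameters; the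
  distinguished variables are 0 in Separation, and 0 (argument) and 1 (value) in Replacement.
\<close>

definition ax_extensionality :: "'a struct \<Rightarrow> bool" where
  "ax_extensionality M \<longleftrightarrow>
     (\<forall>x\<in>dom M. \<forall>y\<in>dom M. (\<forall>z\<in>dom M. mem M z x \<longleftrightarrow> mem M z y) \<longrightarrow> x = y)"

definition ax_foundation :: "'a struct \<Rightarrow> bool" where
  "ax_foundation M \<longleftrightarrow>
     (\<forall>x\<in>dom M. (\<exists>y\<in>dom M. mem M y x) \<longrightarrow>
        (\<exists>y\<in>dom M. mem M y x \<and> \<not> (\<exists>z\<in>dom M. mem M z x \<and> mem M z y)))"

definition is_upair :: "'a struct \<Rightarrow> 'a \<Rightarrow> 'a \<Rightarrow> 'a \<Rightarrow> bool" where
  "is_upair M x y p \<longleftrightarrow> (\<forall>u\<in>dom M. mem M u p \<longleftrightarrow> u = x \<or> u = y)"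

definition ax_pairing :: "'a struct \<Rightarrow> bool" where
  "ax_pairing M \<longleftrightarrow> (\<forall>x\<in>dom M. \<forall>y\<in>dom M. \<exists>p\<in>dom M. is_upair M x y p)"

definition ax_union :: "'a struct \<Rightarrow> bool" where
  "ax_union M \<longleftrightarrow>
     (\<forall>x\<in>dom M. \<exists>y\<in>dom M. \<forall>u\<in>dom M. mem M u y \<longleftrightarrow> (\<exists>v\<in>dom M. mem M v x \<and> mem M u v))"

definition ax_powerset :: "'a struct \<Rightarrow> bool" where
  "ax_powerset M \<longleftrightarrow>
     (\<forall>x\<in>dom M. \<exists>y\<in>dom M. \<forall>u\<in>dom M. mem M u y \<longleftrightarrow> (\<forall>v\<in>dom M. mem M v u \<longrightarrow> mem M v x))"

definition is_empty :: "'a struct \<Rightarrow> 'a \<Rightarrow> bool" where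
  "is_empty M x \<longleftrightarrow> \<not> (\<exists>u\<in>dom M. mem M u x)"

definition is_succ :: "'a struct \<Rightarrow> 'a \<Rightarrow> 'a \<Rightarrow> bool" where
  "is_succ M x y \<longleftrightarrow> (\<forall>u\<in>dom M. mem M u y \<longleftrightarrow> mem M u x \<or> u = x)"

definition is_inductive :: "'a struct \<Rightarrow> 'a \<Rightarrow> bool" where
  "is_inductive M w \<longleftrightarrow>
     (\<exists>e\<in>dom M. is_empty M e \<and> mem M e w) \<and>
     (\<forall>x\<in>dom M. mem M x w \<longrightarrow> (\<exists>y\<in>dom M. is_succ M x y \<and> mem M y w))"

definition ax_infinity :: "'a struct \<Rightarrow> bool" where
  "ax_infinity M \<longleftrightarrow> (\<exists>w\<in>dom M. is_inductive M w)"

definition ax_separation :: "'a struct \<Rightarrow> bool" where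
  "ax_separation M \<longleftrightarrow>
     (\<forall>\<phi> s. range s \<subseteq> dom M \<longrightarrow>
        (\<forall>x\<in>dom M. \<exists>y\<in>dom M. \<forall>u\<in>dom M. mem M u y \<longleftrightarrow> mem M u x \<and> sat M (s(0 := u)) \<phi>))"

definition ax_replacement :: "'a struct \<Rightarrow> bool" where
  "ax_replacement M \<longleftrightarrow>
     (\<forall>\<phi> s. range s \<subseteq> dom M \<longrightarrow>
        (\<forall>x\<in>dom M.
           (\<forall>u\<in>dom M. mem M u x \<longrightarrow> (\<exists>!v. v \<in> dom M \<and> sat M (s(0 := u, 1 := v)) \<phi>)) \<longrightarrow>
           (\<exists>y\<in>dom M. \<forall>v\<in>dom M.
              mem M v y \<longleftrightarrow> (\<exists>u\<in>dom M. mem M u x \<and> sat M (s(0 := u, 1 := v)) \<phi>))))"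

definition ax_choice :: "'a struct \<Rightarrow> bool" where
  "ax_choice M \<longleftrightarrow>
     (\<forall>x\<in>dom M.
        (\<forall>u\<in>dom M. mem M u x \<longrightarrow> (\<exists>v\<in>dom M. mem M v u)) \<and>
        (\<forall>u\<in>dom M. \<forall>v\<in>dom M. mem M u x \<and> mem M v x \<and> u \<noteq> v \<longrightarrow>
           \<not> (\<exists>z\<in>dom M. mem M z u \<and> mem M z v)) \<longrightarrow>
        (\<exists>c\<in>dom M. \<forall>u\<in>dom M. mem M u x \<longrightarrow> (\<exists>!v. v \<in> dom M \<and> mem M v u \<and> mem M v c)))"

definition zfc_model :: "'a struct \<Rightarrow> bool" where
  "zfc_model M \<longleftrightarrow> is_struct M \<and>
     ax_extensionality M \<and> ax_foundation M \<and> ax_pairing M \<and> ax_union M \<and> ax_powerset M \<and>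
     ax_infinity M \<and> ax_separation M \<and> ax_replacement M \<and> ax_choice M"

section \<open>Multiverses and the Wellfoundedness Mirage axiom\<close>

definition multiverse :: "'a struct set \<Rightarrow> bool" where
  "multiverse \<M> \<longleftrightarrow> \<M> \<noteq> {} \<and> (\<forall>M\<in>\<M>. zfc_model M)"

text \<open>The structure \<open>M\<close> thinks that \<open>p\<close> is the Kuratowski pair of \<open>x\<close> and \<open>y\<close>.\<close>

definition is_opair :: "'a struct \<Rightarrow> 'a \<Rightarrow> 'a \<Rightarrow> 'a \<Rightarrow> bool" where
  "is_opair M x y p \<longleftrightarrow>
     (\<exists>s\<in>dom M. \<exists>t\<in>dom M. is_upair M x x s \<and> is_upair M x y t \<and> is_upair M s t p)"

definition is_relation_on :: "'a struct \<Rightarrow> 'a \<Rightarrow> 'a \<Rightarrow> bool" where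
  "is_relation_on N m e \<longleftrightarrow>
     (\<forall>q\<in>dom N. mem N q e \<longrightarrow>
        (\<exists>a\<in>dom N. \<exists>b\<in>dom N. mem N a m \<and> mem N b m \<and> is_opair N a b q))"

definition extern :: "'a struct \<Rightarrow> 'a \<Rightarrow> 'a \<Rightarrow> 'a struct" where
  "extern N m e =
     \<lparr> dom = {a \<in> dom N. mem N a m},
       rel = {(a, b). a \<in> dom N \<and> b \<in> dom N \<and> (\<exists>q\<in>dom N. is_opair N a b q \<and> mem N q e)} \<rparr>"

definition represents :: "'a struct \<Rightarrow> 'a \<Rightarrow> 'a \<Rightarrow> 'b struct \<Rightarrow> bool" where
  "represents N m e M \<longleftrightarrow>
     m \<in> dom N \<and> e \<in> dom N \<and> (\<exists>p\<in>dom N. is_opair N m e p) \<and>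
     is_relation_on N m e \<and> isomorphic (extern N m e) M"

definition is_omega :: "'a struct \<Rightarrow> 'a \<Rightarrow> bool" where
  "is_omega M w \<longleftrightarrow> w \<in> dom M \<and> is_inductive M w \<and>
     (\<forall>v\<in>dom M. is_inductive M v \<longrightarrow> (\<forall>x\<in>dom M. mem M x w \<longrightarrow> mem M x v))"

text \<open>
  \<open>N\<close> thinks that the \<open>\<omega>\<close> of the structure \<open>\<langle>m, e\<rangle>\<close> is ill-founded.  Quantifying over
  \<open>extern N m e\<close> is quantifying inside \<open>N\<close> over the elements of \<open>m\<close>, so that \<open>is_omega\<close> is here
  relativised to \<open>\<langle>m, e\<rangle>\<close> as \<open>N\<close> sees it.  The witnessing nonempty set \<open>S\<close> without a minimal
  element has to be an element of \<open>N\<close>.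
\<close>

definition thinks_omega_illfounded :: "'a struct \<Rightarrow> 'a \<Rightarrow> 'a \<Rightarrow> bool" where
  "thinks_omega_illfounded N m e \<longleftrightarrow>
     (\<exists>w. is_omega (extern N m e) w \<and>
        (\<exists>S\<in>dom N.
           (\<exists>x\<in>dom N. mem N x S) \<and>
           (\<forall>x\<in>dom N. mem N x S \<longrightarrow> mem N x m \<and> mem (extern N m e) x w) \<and>
           (\<forall>x\<in>dom N. mem N x S \<longrightarrow> (\<exists>y\<in>dom N. mem N y S \<and> mem (extern N m e) y x))))"

definition wellfoundedness_mirage :: "'a struct set \<Rightarrow> bool" where
  "wellfoundedness_mirage \<M> \<longleftrightarrow>
     (\<forall>M\<in>\<M>. \<exists>N\<in>\<M>. \<exists>m e. represents N m e M \<and> thinks_omega_illfounded N m e)"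

section \<open>Computable sets of natural numbers\<close>

text \<open>
  In primitive recursion and minimisation the first argument is the recursion (search) variable;
  the step function of \<open>Prec\<close> receives it, then the previous value, then the parameters.
\<close>

datatype recf =
    Zero
  | Succ
  | Proj nat
  | Comp recf "recf list"
  | Prec recf recf
  | Mini recf

inductive evaluates :: "recf \<Rightarrow> nat list \<Rightarrow> nat \<Rightarrow> bool" where
  zero: "evaluates Zero xs 0"
| succ: "evaluates Succ [x] (Suc x)"
| proj: "i < length xs \<Longrightarrow> evaluates (Proj i) xs (xs ! i)"
| comp: "list_all2 (\<lambda>g y. evaluates g xs y) gs ys \<Longrightarrow> evaluates f ys z \<Longrightarrow>
         evaluates (Comp f gs) xs z"
| prec_0: "evaluates f xs z \<Longrightarrow> evaluates (Prec f g) (0 # xs) z"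
| prec_Suc: "evaluates (Prec f g) (n # xs) r \<Longrightarrow> evaluates g (n # r # xs) z \<Longrightarrow>
         evaluates (Prec f g) (Suc n # xs) z"
| mini: "evaluates f (n # xs) 0 \<Longrightarrow> (\<And>k. k < n \<Longrightarrow> \<exists>y. evaluates f (k # xs) (Suc y)) \<Longrightarrow>
         evaluates (Mini f) xs n"

definition computable :: "nat set \<Rightarrow> bool" where
  "computable X \<longleftrightarrow> (\<exists>f. \<forall>n. evaluates f [n] (if n \<in> X then 1 else 0))"

section \<open>Computable saturation\<close>

text \<open>
  The type \<open>p\<close> has variables \<open>0, \<dots>, length a - 1\<close> for the parameters \<open>a\<close> and the next \<open>n\<close>
  variables for the tuple to be found; \<open>nth (a @ b)\<close> assigns \<open>a\<close> and \<open>b\<close> to them.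
\<close>

definition realizes :: "'a struct \<Rightarrow> 'a list \<Rightarrow> 'a list \<Rightarrow> fm set \<Rightarrow> bool" where
  "realizes M a b p \<longleftrightarrow> (\<forall>\<phi>\<in>p. sat M (nth (a @ b)) \<phi>)"

definition realizable :: "'a struct \<Rightarrow> 'a list \<Rightarrow> nat \<Rightarrow> fm set \<Rightarrow> bool" where
  "realizable M a n p \<longleftrightarrow> (\<exists>b. length b = n \<and> set b \<subseteq> dom M \<and> realizes M a b p)"

definition finitely_realizable :: "'a struct \<Rightarrow> 'a list \<Rightarrow> nat \<Rightarrow> fm set \<Rightarrow> bool" where
  "finitely_realizable M a n p \<longleftrightarrow> (\<forall>q. finite q \<and> q \<subseteq> p \<longrightarrow> realizable M a n q)"

definition computably_saturated :: "'a struct \<Rightarrow> bool" where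
  "computably_saturated M \<longleftrightarrow>
     (\<forall>a n p. set a \<subseteq> dom M \<and> (\<forall>\<phi>\<in>p. fv \<phi> \<subseteq> {..<length a + n}) \<and>
        computable (godel ` p) \<and> finitely_realizable M a n p \<longrightarrow> realizable M a n p)"

end

(*
  If K thinks that the omega of N is ill-founded, then omega^N is nonstandard.  So each M in the
  multiverse is a set structure in some N that is itself omega-nonstandard.  Given a computable
  type p over M, finitely realizable, N sees for each standard k a partial satisfaction relation
  for codes below k and an assignment into M satisfying all formulas of p with code below k, where
  membership in p is expressed by a formula representing its decision procedure.  By overspill
  the same holds for a nonstandard k, and the resulting assignment realizes p, since satisfaction
  relations that obey the Tarski clauses are correct at standard formulas.
*)
theory Submission
  imports Defs
begin

text \<open>Overspill applies only to properties definable over \<open>N\<close> with parameters, so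
  every notion in the final property (ordered pairs, representing formulas, Tarski clauses, the
  conditions on the parameters \<open>a\<close>) has to be shown definable. Object formulas are not
  written out for this: \<open>dfn\<close> is a semantic notion of definability whose closure rules
  follow the shape of HOL terms, so a definability proof is backward chaining through
  \<open>dfn_intros\<close>. The type is a set of the metatheory, and computability is what makes it
  visible to \<open>N\<close>: it yields a definable predicate that agrees with the type at standard
  codes. At nonstandard codes this predicate is uncontrolled. That is harmless, because the result
  of overspill is read only at standard codes. For the same reason satisfaction relations and
  computation tables are built just for standard lengths, by induction in the metatheory; overspill
  then supplies the single nonstandard length, which lies above all standard codes at once.\<close>

section \<open>Locality of satisfaction and renaming of variables\<close>

lemma finite_fv: "finite (fv \<phi>)"
  by (induction \<phi>) auto

lemma sat_cong: "(\<And>i. i \<in> fv \<phi> \<Longrightarrow> s i = t i) \<Longrightarrow> sat M s \<phi> \<longleftrightarrow> sat M t \<phi>"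
proof (induction \<phi> arbitrary: s t)
  case (All i \<phi>)
  have "sat M (s(i := x)) \<phi> = sat M (t(i := x)) \<phi>" for x
    by (rule All.IH) (use All.prems in auto)
  then show ?case by simp
next
  case (Conj \<phi> \<psi>)
  have "sat M s \<phi> = sat M t \<phi>" "sat M s \<psi> = sat M t \<psi>"
    by (rule Conj.IH; use Conj.prems in auto)+
  then show ?case by simp
next
  case (Neg \<phi>)
  have "sat M s \<phi> = sat M t \<phi>" by (rule Neg.IH) (use Neg.prems in auto)
  then show ?case by simp
qed auto

text \<open>Under a quantifier the bound variable is replaced by one outside the image of the free
  variables, which prevents capture even when \<open>f\<close> is not injective.\<close>

lemma ex_renaming: "\<exists>\<psi>. \<forall>s. sat M s \<psi> \<longleftrightarrow> sat M (\<lambda>i. s (f i)) \<phi>"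
proof (induction \<phi> arbitrary: f)
  case (Eq i j)
  show ?case by (rule exI[of _ "Eq (f i) (f j)"]) simp
next
  case (Mem i j)
  show ?case by (rule exI[of _ "Mem (f i) (f j)"]) simp
next
  case (Neg \<phi>)
  then obtain \<psi> where "\<forall>s. sat M s \<psi> \<longleftrightarrow> sat M (\<lambda>i. s (f i)) \<phi>" by blast
  then show ?case by (intro exI[of _ "Neg \<psi>"]) simp
next
  case (Conj \<phi>1 \<phi>2)
  obtain \<psi>1 \<psi>2 where "\<forall>s. sat M s \<psi>1 \<longleftrightarrow> sat M (\<lambda>i. s (f i)) \<phi>1"
      "\<forall>s. sat M s \<psi>2 \<longleftrightarrow> sat M (\<lambda>i. s (f i)) \<phi>2"
    using Conj.IH by blast
  then show ?case by (intro exI[of _ "Conj \<psi>1 \<psi>2"]) simp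
next
  case (All i \<phi>)
  obtain v where v: "v \<notin> f ` fv \<phi>"
    using ex_new_if_finite[OF infinite_UNIV_nat] finite_fv by blast
  obtain \<psi> where \<psi>: "\<And>s. sat M s \<psi> \<longleftrightarrow> sat M (\<lambda>j. s ((f(i := v)) j)) \<phi>"
    using All.IH by blast
  have "sat M (s(v := x)) \<psi> \<longleftrightarrow> sat M ((\<lambda>j. s (f j))(i := x)) \<phi>" for s x
    unfolding \<psi> by (rule sat_cong) (use v in auto)
  then show ?case by (intro exI[of _ "All v \<psi>"]) simp
qed

section \<open>Definability with parameters\<close>

text \<open>
  Predicates are functions of an assignment, read with de Bruijn indices: a bound variable
  becomes index 0 and shifts the others.
\<close>

definition dtm :: "'a struct \<Rightarrow> ((nat \<Rightarrow> 'a) \<Rightarrow> 'a) \<Rightarrow> bool" where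
  "dtm N t \<longleftrightarrow> (\<exists>i. t = (\<lambda>s. s i)) \<or> (\<exists>c\<in>dom N. t = (\<lambda>s. c))"

text \<open>The map \<open>g\<close> inserts parameters and rearranges variables without touching
  \<phi>. The equivalence is demanded for every assignment, also with values outside the domain, so
  the closure rules carry no side condition on \<open>s\<close>.\<close>

definition dfn :: "'a struct \<Rightarrow> ((nat \<Rightarrow> 'a) \<Rightarrow> bool) \<Rightarrow> bool" where
  "dfn N P \<longleftrightarrow> (\<exists>\<phi> g. (\<forall>i. dtm N (g i)) \<and> (\<forall>s. P s \<longleftrightarrow> sat N (\<lambda>i. g i s) \<phi>))"

lemma dtm_var: "dtm N (\<lambda>s. s i)"
  and dtm_const: "c \<in> dom N \<Longrightarrow> dtm N (\<lambda>s. c)"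
  by (auto simp: dtm_def)

lemma dtm_shift: "dtm N t \<Longrightarrow> dtm N (\<lambda>s. t (\<lambda>k. s (f k)))"
  by (auto simp: dtm_def)

lemma dfn_eq: "dtm N t \<Longrightarrow> dtm N u \<Longrightarrow> dfn N (\<lambda>s. t s = u s)"
  unfolding dfn_def
  by (rule exI[of _ "Eq 0 1"], rule exI[of _ "\<lambda>i. if i = 0 then t else u"]) simp

lemma dfn_mem: "dtm N t \<Longrightarrow> dtm N u \<Longrightarrow> dfn N (\<lambda>s. mem N (t s) (u s))"
  unfolding dfn_def
  by (rule exI[of _ "Mem 0 1"], rule exI[of _ "\<lambda>i. if i = 0 then t else u"]) simp

lemma dfn_neg: "dfn N P \<Longrightarrow> dfn N (\<lambda>s. \<not> P s)"
  unfolding dfn_def by (metis sat.simps(3))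

lemma dfn_conj:
  assumes "dfn N P" "dfn N Q"
  shows "dfn N (\<lambda>s. P s \<and> Q s)"
proof -
  obtain \<phi> g where g: "\<And>i. dtm N (g i)" "\<And>s. P s \<longleftrightarrow> sat N (\<lambda>i. g i s) \<phi>"
    using assms(1) unfolding dfn_def by blast
  obtain \<psi> h where h: "\<And>i. dtm N (h i)" "\<And>s. Q s \<longleftrightarrow> sat N (\<lambda>i. h i s) \<psi>"
    using assms(2) unfolding dfn_def by blast
  \<comment> \<open>The maps \<open>g\<close> and \<open>h\<close> are unrelated and may clash;
    moving the variables to even and odd indices lets one map serve both formulas.\<close>
  obtain \<phi>' where p: "\<And>s. sat N s \<phi>' \<longleftrightarrow> sat N (\<lambda>i. s (2 * i)) \<phi>"
    using ex_renaming[of N "\<lambda>i. 2 * i" \<phi>] by blast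
  obtain \<psi>' where q: "\<And>s. sat N s \<psi>' \<longleftrightarrow> sat N (\<lambda>i. s (2 * i + 1)) \<psi>"
    using ex_renaming[of N "\<lambda>i. 2 * i + 1" \<psi>] by blast
  show ?thesis
    unfolding dfn_def
    by (rule exI[of _ "Conj \<phi>' \<psi>'"],
        rule exI[of _ "\<lambda>i. if even i then g (i div 2) else h (i div 2)"])
      (simp add: p q g h)
qed

lemma dfn_ball:
  assumes "dfn N (\<lambda>s. Q (\<lambda>k. s (Suc k)) (s 0))"
  shows "dfn N (\<lambda>s. \<forall>x\<in>dom N. Q s x)"
proof -
  obtain \<phi> g where g: "\<And>i. dtm N (g i)"
      "\<And>s. Q (\<lambda>k. s (Suc k)) (s 0) \<longleftrightarrow> sat N (\<lambda>i. g i s) \<phi>"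
    using assms(1) unfolding dfn_def by blast
  have Q: "Q s x \<longleftrightarrow> sat N (\<lambda>i. g i (case_nat x s)) \<phi>" for s x
    using g(2)[of "case_nat x s"] by simp
  \<comment> \<open>All variables that denote the quantified element collapse to \<open>0\<close>,
    the variable bound by \<open>All\<close>; the others move to \<open>Suc i\<close>, out of its
    reach.\<close>
  define f where "f i = (if g i = (\<lambda>s. s 0) then 0 else Suc i)" for i
  obtain \<phi>' where p: "\<And>s. sat N s \<phi>' \<longleftrightarrow> sat N (\<lambda>i. s (f i)) \<phi>"
    using ex_renaming[of N f \<phi>] by blast
  \<comment> \<open>A term other than the bound variable does not see the bound element, so it can
    be shifted down past the quantifier.\<close>
  have "\<exists>u. dtm N u \<and> (g i \<noteq> (\<lambda>s. s 0) \<longrightarrow> (\<forall>s x. u s = g i (case_nat x s)))" for i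
  proof -
    consider "g i = (\<lambda>s. s 0)" | k where "g i = (\<lambda>s. s (Suc k))" | c where "c \<in> dom N" "g i = (\<lambda>s. c)"
    proof -
      consider j where "g i = (\<lambda>s. s j)" | c where "c \<in> dom N" "g i = (\<lambda>s. c)"
        using g(1)[of i] unfolding dtm_def by (elim disjE exE bexE)
      then show thesis
      proof cases
        case (1 j) then show thesis using that by (cases j) simp_all
      next
        case (2 c) then show thesis using that by simp
      qed
    qed
    then show ?thesis
    proof cases
      case 1 then show ?thesis by (intro exI[of _ "\<lambda>s. s 0"]) (simp add: dtm_var)
    next
      case 2 then show ?thesis by (intro exI[of _ "\<lambda>s. s k"]) (simp add: dtm_var)
    next
      case 3 then show ?thesis by (intro exI[of _ "\<lambda>s. c"]) (simp add: dtm_const)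
    qed
  qed
  then have "\<forall>i. \<exists>u. dtm N u \<and> (g i \<noteq> (\<lambda>s. s 0) \<longrightarrow> (\<forall>s x. u s = g i (case_nat x s)))" ..
  from choice[OF this] obtain h where h0:
      "\<forall>i. dtm N (h i) \<and> (g i \<noteq> (\<lambda>s. s 0) \<longrightarrow> (\<forall>s x. h i s = g i (case_nat x s)))" ..
  have h: "dtm N (h i)" "g i \<noteq> (\<lambda>s. s 0) \<Longrightarrow> h i s = g i (case_nat x s)" for i s x
    using h0[THEN spec[of _ i]] by blast+
  have "((\<lambda>i. case_nat (\<lambda>s. s 0) h i s)(0 := x)) (f i) = g i (case_nat x s)" for s x i
    by (cases "g i = (\<lambda>s. s 0)") (auto simp: f_def h(2))
  then have "(\<forall>x\<in>dom N. Q s x) \<longleftrightarrow> sat N (\<lambda>i. case_nat (\<lambda>s. s 0) h i s) (All 0 \<phi>')" for s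
    by (simp add: Q p)
  moreover have "dtm N (case_nat (\<lambda>s. s 0) h i)" for i
    by (cases i) (simp_all add: dtm_var h)
  ultimately show ?thesis
    unfolding dfn_def
    by (intro exI[of _ "All 0 \<phi>'"] exI[of _ "case_nat (\<lambda>s. s 0) h"] conjI allI) simp_all
qed

lemma dfn_disj:
  assumes "dfn N P" "dfn N Q" shows "dfn N (\<lambda>s. P s \<or> Q s)"
  using dfn_neg[OF dfn_conj[OF assms[THEN dfn_neg]]] by (simp only: de_Morgan_conj not_not)

lemma dfn_imp:
  assumes "dfn N P" "dfn N Q" shows "dfn N (\<lambda>s. P s \<longrightarrow> Q s)"
  unfolding imp_conv_disj by (rule dfn_disj[OF dfn_neg[OF assms(1)] assms(2)])

lemma dfn_iff:
  assumes "dfn N P" "dfn N Q" shows "dfn N (\<lambda>s. P s \<longleftrightarrow> Q s)"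
  unfolding iff_conv_conj_imp
  by (rule dfn_conj[OF dfn_imp[OF assms] dfn_imp[OF assms(2,1)]])

lemma dfn_bex:
  assumes "dfn N (\<lambda>s. Q (\<lambda>k. s (Suc k)) (s 0))"
  shows "dfn N (\<lambda>s. \<exists>x\<in>dom N. Q s x)"
  using dfn_neg[OF dfn_ball[where Q = "\<lambda>s x. \<not> Q s x", OF dfn_neg[OF assms]]]
  by (simp only: bex_simps ball_simps not_not)

lemma dfn_const: "dfn N (\<lambda>s. b)"
proof -
  have T: "dfn N (\<lambda>s. True)" using dfn_eq[OF dtm_var[of N 0] dtm_var[of N 0]] by simp
  show ?thesis using T dfn_neg[OF T] by (cases b) simp_all
qed

text \<open>The index \<open>i\<close> ranges over numbers of the metatheory, so this is a finite
  conjunction whose length is \<open>n\<close>.\<close>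

lemma dfn_all_less: "(\<And>i. i < n \<Longrightarrow> dfn N (P i)) \<Longrightarrow> dfn N (\<lambda>s. \<forall>i<n. P i s)" for n :: nat
proof (induction n)
  case 0 show ?case using dfn_const[of N True] by simp
next
  case (Suc n)
  have "dfn N (\<lambda>s. P n s \<and> (\<forall>i<n. P i s))"
    by (intro dfn_conj Suc.IH Suc.prems) simp_all
  then show ?case by (simp add: All_less_Suc)
qed

lemmas dfn_intros = dfn_eq dfn_mem dfn_neg dfn_conj dfn_disj dfn_imp dfn_iff dfn_ball dfn_bex
  dtm_var dtm_const

section \<open>Definability of basic set-theoretic relations\<close>

lemma dfn_is_succ:
  assumes "dtm N x" "dtm N y" shows "dfn N (\<lambda>s. is_succ N (x s) (y s))"
  unfolding is_succ_def by (intro dfn_intros assms[THEN dtm_shift])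

lemma dfn_is_upair:
  assumes "dtm N x" "dtm N y" "dtm N p" shows "dfn N (\<lambda>s. is_upair N (x s) (y s) (p s))"
  unfolding is_upair_def by (intro dfn_intros assms[THEN dtm_shift])

lemma dfn_is_opair:
  assumes "dtm N x" "dtm N y" "dtm N p" shows "dfn N (\<lambda>s. is_opair N (x s) (y s) (p s))"
  unfolding is_opair_def by (intro dfn_intros dfn_is_upair assms[THEN dtm_shift])

definition prel :: "'a struct \<Rightarrow> 'a \<Rightarrow> 'a \<Rightarrow> 'a \<Rightarrow> bool" where
  "prel N F c v \<longleftrightarrow> (\<exists>q\<in>dom N. is_opair N c v q \<and> mem N q F)"

lemma dfn_prel:
  assumes "dtm N x" "dtm N y" "dtm N F" shows "dfn N (\<lambda>s. prel N (F s) (x s) (y s))"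
  unfolding prel_def by (intro dfn_intros dfn_is_opair assms[THEN dtm_shift])

lemmas dfn_set_intros = dfn_is_succ dfn_prel dfn_is_opair

section \<open>Tuples of terms and quantifiers over tuples\<close>

text \<open>The terms are fixed before the assignment, so the length of \<open>L s\<close> is the
  same for all \<open>s\<close>. Such lists serve as argument tuples of recursive functions.\<close>

definition dlist :: "'a struct \<Rightarrow> ((nat \<Rightarrow> 'a) \<Rightarrow> 'a list) \<Rightarrow> bool" where
  "dlist N L \<longleftrightarrow> (\<exists>ts. (\<forall>t\<in>set ts. dtm N t) \<and> L = (\<lambda>s. map (\<lambda>t. t s) ts))"

lemma dlist_Nil: "dlist N (\<lambda>s. [])"
  unfolding dlist_def by (rule exI[of _ "[]"]) simp

lemma dlist_Cons:
  assumes "dtm N t" "dlist N L"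
  shows "dlist N (\<lambda>s. t s # L s)"
proof -
  obtain ts where "\<forall>u\<in>set ts. dtm N u" "L = (\<lambda>s. map (\<lambda>t. t s) ts)"
    using assms(2) unfolding dlist_def by blast
  then show ?thesis using assms(1) unfolding dlist_def by (intro exI[of _ "t # ts"]) simp
qed

lemma dlist_shift:
  assumes "dlist N L" shows "dlist N (\<lambda>s. L (\<lambda>k. s (f k)))"
proof -
  obtain ts where "\<forall>u\<in>set ts. dtm N u" "L = (\<lambda>s. map (\<lambda>t. t s) ts)"
    using assms unfolding dlist_def by blast
  then show ?thesis unfolding dlist_def
    by (intro exI[of _ "map (\<lambda>t s. t (\<lambda>k. s (f k))) ts"]) (auto simp: dtm_shift)
qed

lemma dlist_nth:
  "dlist N L \<Longrightarrow> (\<And>s. i < length (L s)) \<Longrightarrow> dtm N (\<lambda>s. L s ! i)"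
  unfolding dlist_def by auto

lemma dlist_cases:
  assumes "dlist N L"
  obtains "L = (\<lambda>s. [])"
    | t L' where "dtm N t" "dlist N L'" "L = (\<lambda>s. t s # L' s)"
proof -
  obtain ts where ts: "\<forall>u\<in>set ts. dtm N u" "L = (\<lambda>s. map (\<lambda>t. t s) ts)"
    using assms unfolding dlist_def by blast
  show thesis
  proof (cases ts)
    case Nil then show thesis using that(1) ts by simp
  next
    case (Cons t us)
    then show thesis using that(2)[of t "\<lambda>s. map (\<lambda>t. t s) us"] ts unfolding dlist_def by auto
  qed
qed

lemma ex_list_Suc:
  "(\<exists>ys. length ys = Suc n \<and> P ys) \<longleftrightarrow> (\<exists>y ys. length ys = n \<and> P (y # ys))"
proof
  assume "\<exists>ys. length ys = Suc n \<and> P ys"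
  then obtain ys where "length ys = Suc n" "P ys" by blast
  then show "\<exists>y ys. length ys = n \<and> P (y # ys)" by (cases ys) auto
next
  assume "\<exists>y ys. length ys = n \<and> P (y # ys)"
  then obtain y ys where "length ys = n" "P (y # ys)" by blast
  then show "\<exists>ys. length ys = Suc n \<and> P ys" by (intro exI[of _ "y # ys"]) simp
qed

text \<open>A quantifier over tuples of length \<open>n\<close> is \<open>n\<close> nested
  quantifiers over elements. The premise allows a renaming \<open>f\<close> because each of these
  quantifiers shifts the remaining variables of \<open>Q\<close> once more.\<close>

lemma dfn_ex_list:
  assumes "\<And>f L. dlist N L \<Longrightarrow> (\<And>s. length (L s) = n) \<Longrightarrow> dfn N (\<lambda>s. Q (\<lambda>k. s (f k)) (L s))"
  shows "dfn N (\<lambda>s. \<exists>ys. length ys = n \<and> set ys \<subseteq> dom N \<and> Q s ys)"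
  using assms
proof (induction n arbitrary: Q)
  case 0
  show ?case using 0[of "\<lambda>s. []" "\<lambda>k. k"] by (simp add: dlist_Nil)
next
  case (Suc n)
  have "dfn N (\<lambda>s. \<exists>ys. length ys = n \<and> set ys \<subseteq> dom N \<and> Q (\<lambda>k. s (Suc k)) (s 0 # ys))"
  proof (rule Suc.IH)
    fix f :: "nat \<Rightarrow> nat" and L
    assume L: "dlist N L" "\<And>s. length (L s) = n"
    show "dfn N (\<lambda>s. Q (\<lambda>k. s (f (Suc k))) (s (f 0) # L s))"
      by (rule Suc.prems) (auto intro: dlist_Cons dtm_var L)
  qed
  then have "dfn N (\<lambda>s. \<exists>y\<in>dom N. \<exists>ys. length ys = n \<and> set ys \<subseteq> dom N \<and> Q s (y # ys))"
    by (rule dfn_bex)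
  moreover have "(\<exists>ys. length ys = Suc n \<and> set ys \<subseteq> dom N \<and> Q s ys) \<longleftrightarrow>
      (\<exists>y\<in>dom N. \<exists>ys. length ys = n \<and> set ys \<subseteq> dom N \<and> Q s (y # ys))" for s
    by (subst ex_list_Suc) auto
  ultimately show ?case by simp
qed

definition dfnl :: "'a struct \<Rightarrow> ('a list \<Rightarrow> 'a \<Rightarrow> bool) \<Rightarrow> bool" where
  "dfnl N R \<longleftrightarrow> (\<forall>L t. dlist N L \<longrightarrow> dtm N t \<longrightarrow> dfn N (\<lambda>s. R (L s) (t s)))"

lemma dfnlD: "dfnl N R \<Longrightarrow> dlist N L \<Longrightarrow> dtm N t \<Longrightarrow> dfn N (\<lambda>s. R (L s) (t s))"
  unfolding dfnl_def by blast

section \<open>Set theory inside a model\<close>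

text \<open>The von Neumann numerals of \<open>N\<close>; their range is the standard part of its
  omega.\<close>

primrec num :: "'a struct \<Rightarrow> nat \<Rightarrow> 'a" where
  "num N 0 = (THE x. x \<in> dom N \<and> is_empty N x)"
| "num N (Suc n) = (THE y. y \<in> dom N \<and> is_succ N (num N n) y)"

declare num.simps [simp del]

locale zfc_struct =
  fixes N :: "'a struct"
  assumes zfc: "zfc_model N"
begin

abbreviation "U \<equiv> dom N"
abbreviation E (infix \<open>\<epsilon>\<close> 50) where "x \<epsilon> y \<equiv> mem N x y"

lemma memU: "x \<epsilon> y \<Longrightarrow> x \<in> U" "x \<epsilon> y \<Longrightarrow> y \<in> U"
  using zfc unfolding zfc_model_def is_struct_def by auto

lemma ext: "y \<in> U \<Longrightarrow> z \<in> U \<Longrightarrow> (\<And>u. u \<epsilon> y \<longleftrightarrow> u \<epsilon> z) \<Longrightarrow> y = z"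
  using zfc unfolding zfc_model_def ax_extensionality_def by blast

lemma sep:
  assumes "dfn N (\<lambda>s. Q (s 0))" "x \<in> U"
  obtains y where "y \<in> U" "\<And>u. u \<epsilon> y \<longleftrightarrow> u \<epsilon> x \<and> Q u"
proof -
  obtain \<phi> g where g: "\<And>i. dtm N (g i)" "\<And>s. Q (s 0) \<longleftrightarrow> sat N (\<lambda>i. g i s) \<phi>"
    using assms(1) unfolding dfn_def by blast
  \<comment> \<open>The predicate reads its assignment only at \<open>0\<close>, so a constant
    assignment may be used, under which every variable takes the value \<open>u\<close>.\<close>
  have Q: "Q u \<longleftrightarrow> sat N (\<lambda>i. g i (\<lambda>_. u)) \<phi>" for u
    using g(2)[of "\<lambda>_. u"] by simp
  define isv where "isv i \<longleftrightarrow> (\<exists>k. g i = (\<lambda>s. s k))" for i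
  define f where "f i = (if isv i then 0 else Suc i)" for i
  \<comment> \<open>Index \<open>0\<close> is kept for the element under test and the parameters sit
    above it. The axiom wants all values in the domain, so \<open>x\<close> fills the other
    places.\<close>
  define par where "par = case_nat x (\<lambda>i. if isv i then x else g i undefined)"
  obtain \<phi>' where p: "\<And>s. sat N s \<phi>' \<longleftrightarrow> sat N (\<lambda>i. s (f i)) \<phi>"
    using ex_renaming[of N f \<phi>] by blast
  have "(par(0 := u)) (f i) = g i (\<lambda>_. u)" for u i
    using g(1)[of i] unfolding dtm_def par_def f_def isv_def by (auto dest: fun_cong[of _ _ "\<lambda>_. u"])
  then have sat: "sat N (par(0 := u)) \<phi>' \<longleftrightarrow> Q u" for u
    by (simp only: p Q)
  have "par i \<in> U" for i
    using g(1)[of "i - 1"] assms(2) unfolding dtm_def par_def isv_def by (cases i) auto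
  then have "range par \<subseteq> U" by blast
  moreover have "ax_separation N" using zfc unfolding zfc_model_def by blast
  ultimately have "\<exists>y\<in>U. \<forall>u\<in>U. u \<epsilon> y \<longleftrightarrow> u \<epsilon> x \<and> sat N (par(0 := u)) \<phi>'"
    unfolding ax_separation_def using assms(2) by blast
  then show thesis using that memU sat by (metis (full_types))
qed

section \<open>Pairs, unions, power sets and successors in a model\<close>

lemma ex_upair: "x \<in> U \<Longrightarrow> y \<in> U \<Longrightarrow> \<exists>p\<in>U. is_upair N x y p"
  using zfc unfolding zfc_model_def ax_pairing_def by blast

lemma is_upair_iff: "x \<in> U \<Longrightarrow> y \<in> U \<Longrightarrow> is_upair N x y p \<longleftrightarrow> {u. u \<epsilon> p} = {x, y}"
  unfolding is_upair_def using memU by blast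

lemma ex_union:
  assumes "x \<in> U" obtains y where "y \<in> U" "\<And>u. u \<epsilon> y \<longleftrightarrow> (\<exists>v. v \<epsilon> x \<and> u \<epsilon> v)"
proof -
  have "ax_union N" using zfc unfolding zfc_model_def by blast
  from bspec[OF this[unfolded ax_union_def] assms]
  obtain y where y: "y \<in> U" "\<forall>u\<in>U. u \<epsilon> y \<longleftrightarrow> (\<exists>v\<in>U. v \<epsilon> x \<and> u \<epsilon> v)" ..
  have "u \<epsilon> y \<longleftrightarrow> (\<exists>v. v \<epsilon> x \<and> u \<epsilon> v)" for u
    using y bspec[OF y(2), of u] memU by metis
  then show thesis by (rule that[OF y(1)])
qed

lemma ex_Un:
  assumes "x \<in> U" "y \<in> U" obtains z where "z \<in> U" "\<And>u. u \<epsilon> z \<longleftrightarrow> u \<epsilon> x \<or> u \<epsilon> y"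
proof -
  obtain p where p: "p \<in> U" "{u. u \<epsilon> p} = {x, y}"
    using ex_upair[OF assms] is_upair_iff[OF assms] by blast
  then have p': "u \<epsilon> p \<longleftrightarrow> u = x \<or> u = y" for u by blast
  from ex_union[OF p(1)] obtain z where "z \<in> U" "\<And>u. u \<epsilon> z \<longleftrightarrow> (\<exists>v. v \<epsilon> p \<and> u \<epsilon> v)" by blast
  then show thesis using that p' by metis
qed

lemma ex_Pow:
  assumes "x \<in> U" obtains y where "y \<in> U" "\<And>u. u \<in> U \<Longrightarrow> u \<epsilon> y \<longleftrightarrow> (\<forall>v. v \<epsilon> u \<longrightarrow> v \<epsilon> x)"
proof -
  have "ax_powerset N" using zfc unfolding zfc_model_def by blast
  from bspec[OF this[unfolded ax_powerset_def] assms]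
  obtain y where y: "y \<in> U" "\<forall>u\<in>U. u \<epsilon> y \<longleftrightarrow> (\<forall>v\<in>U. v \<epsilon> u \<longrightarrow> v \<epsilon> x)" ..
  have "u \<epsilon> y \<longleftrightarrow> (\<forall>v. v \<epsilon> u \<longrightarrow> v \<epsilon> x)" if "u \<in> U" for u
    using bspec[OF y(2) that] memU by blast
  then show thesis by (rule that[OF y(1)])
qed

lemma ex_succ:
  assumes "x \<in> U" obtains y where "y \<in> U" "is_succ N x y"
proof -
  obtain p where p: "p \<in> U" "{u. u \<epsilon> p} = {x, x}"
    using ex_upair[OF assms assms] is_upair_iff[OF assms assms] by blast
  obtain z where "z \<in> U" "\<And>u. u \<epsilon> z \<longleftrightarrow> u \<epsilon> x \<or> u \<epsilon> p"
    using ex_Un[OF assms p(1)] by blast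
  then show thesis using that p unfolding is_succ_def by auto
qed

lemma is_succ_iff: "x \<in> U \<Longrightarrow> is_succ N x y \<longleftrightarrow> {u. u \<epsilon> y} = insert x {u. u \<epsilon> x}"
  unfolding is_succ_def using memU by blast

lemma succ_unique: "x \<in> U \<Longrightarrow> y \<in> U \<Longrightarrow> z \<in> U \<Longrightarrow> is_succ N x y \<Longrightarrow> is_succ N x z \<Longrightarrow> y = z"
  by (rule ext) (auto simp: is_succ_iff)

lemma is_empty_iff: "is_empty N x \<longleftrightarrow> {u. u \<epsilon> x} = {}"
  unfolding is_empty_def using memU by blast

lemma empty_unique: "x \<in> U \<Longrightarrow> y \<in> U \<Longrightarrow> is_empty N x \<Longrightarrow> is_empty N y \<Longrightarrow> x = y"
  by (rule ext) (auto simp: is_empty_iff)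

lemma ex_empty: "\<exists>x\<in>U. is_empty N x"
proof -
  obtain x where "x \<in> U" using zfc unfolding zfc_model_def is_struct_def by blast
  from sep[OF dfn_const[of N False] this] show ?thesis unfolding is_empty_def by metis
qed

section \<open>Standard numerals\<close>

lemma num_zero: "num N 0 \<in> U \<and> is_empty N (num N 0)"
proof -
  obtain x where x: "x \<in> U" "is_empty N x" using ex_empty by blast
  show ?thesis unfolding num.simps by (rule theI[of _ x]) (use x empty_unique in blast)+
qed

lemma numU: "num N n \<in> U"
  and num_Suc: "is_succ N (num N n) (num N (Suc n))"
proof -
  have Suc: "num N (Suc n) \<in> U \<and> is_succ N (num N n) (num N (Suc n))" if n: "num N n \<in> U" for n
  proof -
    obtain y where y: "y \<in> U" "is_succ N (num N n) y" using ex_succ[OF n] by blast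
    show ?thesis unfolding num.simps by (rule theI[of _ y]) (use y succ_unique n in blast)+
  qed
  show *: "num N n \<in> U" for n by (induction n) (use num_zero Suc in blast)+
  show "is_succ N (num N n) (num N (Suc n))" using Suc * by blast
qed

lemma mem_num: "y \<epsilon> num N n \<longleftrightarrow> (\<exists>j<n. y = num N j)"
proof (induction n)
  case 0 show ?case using num_zero is_empty_iff by auto
next
  case (Suc n)
  have "y \<epsilon> num N (Suc n) \<longleftrightarrow> y = num N n \<or> y \<epsilon> num N n"
    using num_Suc is_succ_iff[OF numU] by auto
  then show ?case using Suc less_Suc_eq by auto
qed

lemma not_num_mem_num: "\<not> num N n \<epsilon> num N n"
proof (induction n rule: less_induct)
  case (less n)
  then show ?case by (metis mem_num)
qed

lemma num_inject: "num N i = num N j \<longleftrightarrow> i = j"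
  by (metis linorder_neqE_nat mem_num not_num_mem_num)

lemma num_mem_num: "num N i \<epsilon> num N j \<longleftrightarrow> i < j"
  by (auto simp: mem_num num_inject)

lemma succ_num_iff: "y \<in> U \<Longrightarrow> is_succ N (num N n) y \<longleftrightarrow> y = num N (Suc n)"
  using succ_unique[OF numU _ numU _ num_Suc] num_Suc by blast

lemma mem_succ: "x \<in> U \<Longrightarrow> is_succ N x y \<Longrightarrow> u \<epsilon> y \<longleftrightarrow> u \<epsilon> x \<or> u = x"
  by (auto simp: is_succ_iff)

lemma succ_eq_num:
  assumes x: "x \<in> U" and s: "is_succ N x (num N n)"
  obtains i where "n = Suc i" "x = num N i"
proof -
  have "x \<epsilon> num N n" using mem_succ[OF x s] by blast
  then obtain i where i: "i < n" "x = num N i" using mem_num by blast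
  then have "n = Suc i" using s succ_num_iff[OF numU] num_inject by blast
  then show thesis using that i by blast
qed

section \<open>Ordered pairs and definable relations as sets\<close>

text \<open>Reading the internal pair as a set of sets of the metatheory reduces its injectivity to
  that of Kuratowski pairs there.\<close>

lemma is_opairD:
  assumes "x \<in> U" "y \<in> U" "is_opair N x y p"
  shows "(\<lambda>z. {u. u \<epsilon> z}) ` {z. z \<epsilon> p} = {{x}, {x, y}}"
proof -
  obtain s t where st: "s \<in> U" "t \<in> U" "is_upair N x x s" "is_upair N x y t" "is_upair N s t p"
    using assms(3) unfolding is_opair_def by blast
  then have "{u. u \<epsilon> s} = {x}" "{u. u \<epsilon> t} = {x, y}" "{z. z \<epsilon> p} = {s, t}"
    using assms by (auto simp only: is_upair_iff insert_absorb2)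
  then show ?thesis by simp
qed

lemma opair_inject:
  assumes "x \<in> U" "y \<in> U" "x' \<in> U" "y' \<in> U" "is_opair N x y p" "is_opair N x' y' p"
  shows "x = x' \<and> y = y'"
  using is_opairD[OF assms(1,2,5)] is_opairD[OF assms(3,4,6)] by (auto simp: doubleton_eq_iff)

lemma ex_opair:
  assumes "x \<in> U" "y \<in> U" shows "\<exists>p\<in>U. is_opair N x y p"
  unfolding is_opair_def using ex_upair assms by meson

text \<open>Kuratowski pairs from \<open>X\<close> and \<open>Y\<close> lie in the double power set
  of the union of \<open>X\<close> and \<open>Y\<close>.\<close>

lemma ex_pair_set:
  assumes "X \<in> U" "Y \<in> U"
  obtains B where "B \<in> U" "\<And>x y p. x \<epsilon> X \<Longrightarrow> y \<epsilon> Y \<Longrightarrow> p \<in> U \<Longrightarrow> is_opair N x y p \<Longrightarrow> p \<epsilon> B"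
proof -
  obtain Z where Z: "Z \<in> U" "\<And>u. u \<epsilon> Z \<longleftrightarrow> u \<epsilon> X \<or> u \<epsilon> Y" using ex_Un[OF assms] by blast
  obtain A where A: "A \<in> U" "\<And>u. u \<in> U \<Longrightarrow> u \<epsilon> A \<longleftrightarrow> (\<forall>v. v \<epsilon> u \<longrightarrow> v \<epsilon> Z)"
    using ex_Pow[OF Z(1)] by blast
  obtain B where B: "B \<in> U" "\<And>u. u \<in> U \<Longrightarrow> u \<epsilon> B \<longleftrightarrow> (\<forall>v. v \<epsilon> u \<longrightarrow> v \<epsilon> A)"
    using ex_Pow[OF A(1)] by blast
  show thesis
  proof (rule that[OF B(1)])
    fix x y p assume x: "x \<epsilon> X" and y: "y \<epsilon> Y" and p: "p \<in> U" "is_opair N x y p"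
    have xy: "x \<in> U" "y \<in> U" using x y memU by blast+
    have "v \<epsilon> A" if "v \<epsilon> p" for v
    proof -
      have "{u. u \<epsilon> v} \<in> {{x}, {x, y}}"
        unfolding is_opairD[OF xy p(2), symmetric] by (rule imageI) (simp add: that)
      then have "z = x \<or> z = y" if "z \<epsilon> v" for z using that by auto
      then show ?thesis unfolding A(2)[OF memU(1)[OF that]] using Z(2) x y by blast
    qed
    then show "p \<epsilon> B" unfolding B(2)[OF p(1)] by blast
  qed
qed

text \<open>The bound \<open>B\<close> is chosen before \<open>Q\<close>. Hence all the relations
  obtained are subsets of one set, which later allows the assignments to be collected into an
  element of \<open>N\<close>.\<close>

lemma rel_comprehension:
  assumes "X \<in> U" "Y \<in> U"
  obtains B where "B \<in> U" "\<And>Q. (\<And>t u. dtm N t \<Longrightarrow> dtm N u \<Longrightarrow> dfn N (\<lambda>s. Q (t s) (u s))) \<Longrightarrow>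
    \<exists>F\<in>U. (\<forall>q. q \<epsilon> F \<longrightarrow> q \<epsilon> B) \<and>
      (\<forall>c\<in>U. \<forall>v\<in>U. prel N F c v \<longleftrightarrow> c \<epsilon> X \<and> v \<epsilon> Y \<and> Q c v)"
proof -
  obtain B where B: "B \<in> U"
    "\<And>x y p. x \<epsilon> X \<Longrightarrow> y \<epsilon> Y \<Longrightarrow> p \<in> U \<Longrightarrow> is_opair N x y p \<Longrightarrow> p \<epsilon> B"
    using ex_pair_set[OF assms] by blast
  show thesis
  proof (rule that[OF B(1)])
    fix Q assume Q: "\<And>t u. dtm N t \<Longrightarrow> dtm N u \<Longrightarrow> dfn N (\<lambda>s. Q (t s) (u s))"
    define R where "R q \<longleftrightarrow> (\<exists>c\<in>U. \<exists>v\<in>U. c \<epsilon> X \<and> v \<epsilon> Y \<and> is_opair N c v q \<and> Q c v)" for q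
    have "dfn N (\<lambda>s. R (s 0))"
      unfolding R_def by (intro dfn_intros dfn_is_opair Q assms)
    from sep[OF this B(1)] obtain F where F: "F \<in> U" "\<And>u. u \<epsilon> F \<longleftrightarrow> u \<epsilon> B \<and> R u" by blast
    have "prel N F c v \<longleftrightarrow> c \<epsilon> X \<and> v \<epsilon> Y \<and> Q c v" if cv: "c \<in> U" "v \<in> U" for c v
    proof
      assume "prel N F c v"
      then obtain q where q: "q \<in> U" "is_opair N c v q" "q \<epsilon> F" unfolding prel_def by blast
      then obtain c' v' where "c' \<in> U" "v' \<in> U" "c' \<epsilon> X" "v' \<epsilon> Y" "is_opair N c' v' q" "Q c' v'"
        using F(2) R_def by blast
      then show "c \<epsilon> X \<and> v \<epsilon> Y \<and> Q c v" using opair_inject[OF cv _ _ q(2)] by blast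
    next
      assume *: "c \<epsilon> X \<and> v \<epsilon> Y \<and> Q c v"
      obtain q where q: "q \<in> U" "is_opair N c v q" using ex_opair[OF cv] by blast
      then have "q \<epsilon> F" unfolding F(2) R_def using * cv B(2) by blast
      then show "prel N F c v" unfolding prel_def using q by blast
    qed
    then show "\<exists>F\<in>U. (\<forall>q. q \<epsilon> F \<longrightarrow> q \<epsilon> B) \<and>
      (\<forall>c\<in>U. \<forall>v\<in>U. prel N F c v \<longleftrightarrow> c \<epsilon> X \<and> v \<epsilon> Y \<and> Q c v)"
      using F by blast
  qed
qed

lemma ex_rel:
  assumes "X \<in> U" "Y \<in> U" "\<And>t u. dtm N t \<Longrightarrow> dtm N u \<Longrightarrow> dfn N (\<lambda>s. Q (t s) (u s))"
  obtains F where "F \<in> U" "\<And>c v. c \<in> U \<Longrightarrow> v \<in> U \<Longrightarrow> prel N F c v \<longleftrightarrow> c \<epsilon> X \<and> v \<epsilon> Y \<and> Q c v"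
proof (rule rel_comprehension[OF assms(1,2)])
  fix B assume *: "\<And>Q. (\<And>t u. dtm N t \<Longrightarrow> dtm N u \<Longrightarrow> dfn N (\<lambda>s. Q (t s) (u s))) \<Longrightarrow>
    \<exists>F\<in>U. (\<forall>q. q \<epsilon> F \<longrightarrow> q \<epsilon> B) \<and>
      (\<forall>c\<in>U. \<forall>v\<in>U. prel N F c v \<longleftrightarrow> c \<epsilon> X \<and> v \<epsilon> Y \<and> Q c v)"
  show thesis using *[of Q, OF assms(3)] that by blast
qed

end

section \<open>Nonstandard natural numbers and overspill\<close>

locale zfc_omega = zfc_struct +
  fixes w
  assumes omega: "is_omega N w"
begin

lemma wU: "w \<in> U" using omega unfolding is_omega_def by blast

lemma num_w: "num N n \<epsilon> w"
proof (induction n)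
  case 0
  obtain e where "e \<in> U" "is_empty N e" "e \<epsilon> w"
    using omega unfolding is_omega_def is_inductive_def by blast
  then show ?case using num_zero empty_unique by blast
next
  case (Suc n)
  then obtain y where "y \<in> U" "is_succ N (num N n) y" "y \<epsilon> w"
    using omega numU unfolding is_omega_def is_inductive_def by blast
  then show ?case by (simp add: succ_num_iff)
qed

lemma omega_induct:
  assumes dfn: "dfn N (\<lambda>s. Q (s 0))"
    and 0: "Q (num N 0)"
    and step: "\<And>x y. x \<epsilon> w \<Longrightarrow> Q x \<Longrightarrow> y \<in> U \<Longrightarrow> is_succ N x y \<Longrightarrow> Q y"
    and x: "x \<epsilon> w"
  shows "Q x"
proof -
  obtain v where v: "v \<in> U" "\<And>u. u \<epsilon> v \<longleftrightarrow> u \<epsilon> w \<and> Q u" using sep[OF dfn wU] by blast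
  have "is_inductive N v"
    unfolding is_inductive_def
  proof (intro conjI ballI impI)
    show "\<exists>e\<in>U. is_empty N e \<and> e \<epsilon> v" using num_zero 0 num_w v by blast
    fix x assume "x \<in> U" "x \<epsilon> v"
    moreover then obtain y where "y \<in> U" "is_succ N x y" "y \<epsilon> w"
      using omega v(2) unfolding is_omega_def is_inductive_def by blast
    ultimately show "\<exists>y\<in>U. is_succ N x y \<and> y \<epsilon> v" using step v(2) by blast
  qed
  then show ?thesis using omega v x memU unfolding is_omega_def by blast
qed

text \<open>If \<open>Q\<close> failed at every nonstandard number, it would hold in
  \<open>w\<close> exactly at the standard ones, hence be preserved by successor, and induction
  inside \<open>N\<close> would carry it to \<open>k\<close>.\<close>

lemma overspill:
  assumes dfn: "dfn N (\<lambda>s. Q (s 0))" and Q: "\<And>n. Q (num N n)"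
    and k: "k \<epsilon> w" "\<And>n. k \<noteq> num N n"
  shows "\<exists>k. k \<epsilon> w \<and> (\<forall>n. k \<noteq> num N n) \<and> Q k"
proof (rule ccontr)
  assume contra: "\<not> ?thesis"
  have "Q k"
  proof (rule omega_induct[OF dfn Q _ k(1)])
    fix x y assume "x \<epsilon> w" "Q x" "y \<in> U" "is_succ N x y"
    then show "Q y" using contra Q succ_num_iff by metis
  qed
  then show False using contra k by blast
qed

text \<open>Two inductions are nested: on \<open>n\<close> in the metatheory and, for fixed
  \<open>n\<close>, on \<open>x\<close> inside \<open>N\<close>.\<close>

lemma num_trichotomy: "x \<epsilon> w \<Longrightarrow> (\<exists>i\<le>n. x = num N i) \<or> num N n \<epsilon> x"
proof (induction n arbitrary: x)
  case 0
  have "x = num N 0 \<or> num N 0 \<epsilon> x"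
  proof (rule omega_induct[OF _ _ _ 0])
    show "dfn N (\<lambda>s. s 0 = num N 0 \<or> num N 0 \<epsilon> s 0)" by (intro dfn_intros numU)
    fix x y assume "x \<epsilon> w" "x = num N 0 \<or> num N 0 \<epsilon> x" "is_succ N x y"
    then show "y = num N 0 \<or> num N 0 \<epsilon> y" using mem_succ[OF memU(1), of x w y] by blast
  qed simp
  then show ?case by blast
next
  case (Suc n)
  have "num N n \<epsilon> x \<longrightarrow> x = num N (Suc n) \<or> num N (Suc n) \<epsilon> x"
  proof (rule omega_induct[OF _ _ _ Suc.prems])
    show "dfn N (\<lambda>s. num N n \<epsilon> s 0 \<longrightarrow> s 0 = num N (Suc n) \<or> num N (Suc n) \<epsilon> s 0)"
      by (intro dfn_intros numU)
    show "num N n \<epsilon> num N 0 \<longrightarrow> num N 0 = num N (Suc n) \<or> num N (Suc n) \<epsilon> num N 0"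
      by (simp add: num_mem_num)
    fix x y
    assume "x \<epsilon> w" "num N n \<epsilon> x \<longrightarrow> x = num N (Suc n) \<or> num N (Suc n) \<epsilon> x"
      and y: "y \<in> U" "is_succ N x y"
    then show "num N n \<epsilon> y \<longrightarrow> y = num N (Suc n) \<or> num N (Suc n) \<epsilon> y"
      using mem_succ[OF memU(1), of x w y] succ_num_iff[OF y(1)] by metis
  qed
  then show ?case using Suc.IH[OF Suc.prems] by (metis le_Suc_eq)
qed

lemma nonstandard_above:
  assumes "k \<epsilon> w" "\<And>n. k \<noteq> num N n" shows "num N n \<epsilon> k"
  using num_trichotomy assms by blast

text \<open>Here \<open>S\<close> is an arbitrary set of the metatheory, since the ill-founded set
  will be known to another model only. The standard numbers are wellfounded from outside, so
  \<open>S\<close> cannot contain any of them.\<close>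

lemma ex_nonstandard:
  assumes S: "S \<noteq> {}" "\<And>x. x \<in> S \<Longrightarrow> x \<epsilon> w" "\<And>x. x \<in> S \<Longrightarrow> \<exists>y\<in>S. y \<epsilon> x"
  shows "\<exists>k. k \<epsilon> w \<and> (\<forall>n. k \<noteq> num N n)"
proof (rule ccontr)
  assume "\<not> ?thesis"
  then have std: "\<exists>n. x = num N n" if "x \<in> S" for x using S(2) that by blast
  have "num N n \<notin> S" for n
  proof (induction n rule: less_induct)
    case (less n)
    show ?case
    proof
      assume "num N n \<in> S"
      then obtain y where y: "y \<in> S" "y \<epsilon> num N n" using S(3) by blast
      from y(2) obtain j where "j < n" "y = num N j" unfolding mem_num by blast
      with less y(1) show False by blast
    qed
  qed
  then show False using std S(1) by blast
qed

text \<open>Only standardly many steps are needed, so the recursion is unrolled in the metatheory.\<close>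

lemma finite_recursion:
  assumes A: "A \<in> U"
    and dfn: "\<And>F t u. F \<in> U \<Longrightarrow> dtm N t \<Longrightarrow> dtm N u \<Longrightarrow> dfn N (\<lambda>s. C F (t s) (u s))"
    and loc: "\<And>F F' c v. F \<in> U \<Longrightarrow> F' \<in> U \<Longrightarrow> c \<epsilon> w \<Longrightarrow> v \<epsilon> A \<Longrightarrow>
      (\<And>d v. d \<epsilon> c \<Longrightarrow> v \<epsilon> A \<Longrightarrow> prel N F d v \<longleftrightarrow> prel N F' d v) \<Longrightarrow> C F c v \<Longrightarrow> C F' c v"
  shows "\<exists>F\<in>U. \<forall>j<n. \<forall>v. v \<epsilon> A \<longrightarrow> (prel N F (num N j) v \<longleftrightarrow> C F (num N j) v)"
proof (induction n)
  case 0
  show ?case using A by auto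
next
  case (Suc n)
  then obtain F where F: "F \<in> U"
      "\<And>j v. j < n \<Longrightarrow> v \<epsilon> A \<Longrightarrow> prel N F (num N j) v \<longleftrightarrow> C F (num N j) v" by blast
  \<comment> \<open>The new relation keeps the rows of \<open>F\<close> below \<open>n\<close>,
    computes row \<open>n\<close> from \<open>F\<close>, and discards everything else.\<close>
  define Q where "Q c v \<longleftrightarrow> c \<epsilon> num N n \<and> prel N F c v \<or> c = num N n \<and> C F c v" for c v
  have "dfn N (\<lambda>s. Q (t s) (u s))" if "dtm N t" "dtm N u" for t u
    unfolding Q_def by (intro dfn_intros dfn_prel dfn that numU F(1))
  from ex_rel[where Q = Q, OF wU A this] obtain F' where F': "F' \<in> U"
      "\<And>c v. c \<in> U \<Longrightarrow> v \<in> U \<Longrightarrow> prel N F' c v \<longleftrightarrow> c \<epsilon> w \<and> v \<epsilon> A \<and> Q c v"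
    by blast
  have F'n: "prel N F' (num N j) v \<longleftrightarrow> (if j < n then prel N F (num N j) v else j = n \<and> C F (num N j) v)"
    if "v \<epsilon> A" for j v
    using F'(2)[OF numU memU(1)[OF that]] that num_w unfolding Q_def
    by (auto simp: num_mem_num num_inject)
  \<comment> \<open>By locality the clause at \<open>j\<close> inspects only rows below
    \<open>j\<close>, and on these the old and the new relation coincide.\<close>
  have "C F' (num N j) v \<longleftrightarrow> C F (num N j) v" if "j \<le> n" "v \<epsilon> A" for j v
  proof -
    have agree: "prel N F' d v \<longleftrightarrow> prel N F d v" if d: "d \<epsilon> num N j" and v: "v \<epsilon> A" for d v
    proof -
      obtain i where "i < j" "d = num N i" using d unfolding mem_num by blast
      then show ?thesis using F'n[OF v, of i] \<open>j \<le> n\<close> by simp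
    qed
    show ?thesis
    proof
      assume "C F' (num N j) v"
      then show "C F (num N j) v"
        by (rule loc[OF F'(1) F(1) num_w that(2), rotated]) (rule agree)
    next
      assume "C F (num N j) v"
      then show "C F' (num N j) v"
        by (rule loc[OF F(1) F'(1) num_w that(2), rotated]) (rule agree[symmetric])
    qed
  qed
  then have "prel N F' (num N j) v \<longleftrightarrow> C F' (num N j) v" if "j < Suc n" "v \<epsilon> A" for j v
    using that F(2)[of j v] F'n[of v j] by (cases "j < n") simp_all
  then show ?case using F'(1) by blast
qed

end

section \<open>Computable functions are representable\<close>

inductive_cases evaluates_ZeroE: "evaluates Zero xs y"
inductive_cases evaluates_SuccE: "evaluates Succ xs y"
inductive_cases evaluates_ProjE: "evaluates (Proj i) xs y"
inductive_cases evaluates_CompE: "evaluates (Comp f gs) xs y"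
inductive_cases evaluates_PrecE: "evaluates (Prec f g) xs y"
inductive_cases evaluates_Prec0E: "evaluates (Prec f g) (0 # xs) y"
inductive_cases evaluates_PrecSucE: "evaluates (Prec f g) (Suc n # xs) y"
inductive_cases evaluates_MiniE: "evaluates (Mini f) xs y"

text \<open>Unwinds a derivation into a table of values, the counterpart outside \<open>N\<close> of
  the set \<open>H\<close> in \<open>repr_Prec\<close>.\<close>

lemma evaluates_Prec_values:
  "evaluates (Prec f g) (n # xs) y \<Longrightarrow>
    \<exists>val. evaluates f xs (val 0) \<and> (\<forall>j<n. evaluates g (j # val j # xs) (val (Suc j))) \<and> val n = y"
proof (induction n arbitrary: y)
  case 0
  then have "evaluates f xs y" by (rule evaluates_Prec0E)
  then show ?case by (intro exI[of _ "\<lambda>_. y"]) simp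
next
  case (Suc n)
  from Suc.prems obtain r where r: "evaluates (Prec f g) (n # xs) r" "evaluates g (n # r # xs) y"
    by (rule evaluates_PrecSucE)
  from Suc.IH[OF r(1)] obtain val where val: "evaluates f xs (val 0)"
    "\<forall>j<n. evaluates g (j # val j # xs) (val (Suc j))" "val n = r" by blast
  show ?case
    by (rule exI[of _ "val(Suc n := y)"]) (use val r(2) in \<open>auto simp: less_Suc_eq\<close>)
qed

context zfc_omega
begin

text \<open>Only converging computations on standard arguments are constrained, which accommodates
  the partial functions produced by \<open>Mini\<close>. For these, \<open>v\<close> runs through
  the whole domain, so nonstandard values are excluded too; composition and minimisation rely on
  that.\<close>

definition repr :: "recf \<Rightarrow> ('a list \<Rightarrow> 'a \<Rightarrow> bool) \<Rightarrow> bool" where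
  "repr f R \<longleftrightarrow> dfnl N R \<and>
     (\<forall>xs y. evaluates f xs y \<longrightarrow> (\<forall>v\<in>U. R (map (num N) xs) v \<longleftrightarrow> v = num N y))"

lemma repr_dfn: "repr f R \<Longrightarrow> dlist N L \<Longrightarrow> dtm N t \<Longrightarrow> dfn N (\<lambda>s. R (L s) (t s))"
  unfolding repr_def by (blast intro: dfnlD)

lemma reprD: "repr f R \<Longrightarrow> evaluates f xs y \<Longrightarrow> v \<in> U \<Longrightarrow> R (map (num N) xs) v \<longleftrightarrow> v = num N y"
  unfolding repr_def by blast

lemma repr_Zero: "repr Zero (\<lambda>xs y. y = num N 0)"
  unfolding repr_def dfnl_def
proof (intro conjI allI impI ballI)
  fix L t assume "dtm N t" then show "dfn N (\<lambda>s. t s = num N 0)"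
    by (intro dfn_intros numU)
next
  fix xs y v assume "evaluates Zero xs y"
  then show "v = num N 0 \<longleftrightarrow> v = num N y" by (rule evaluates_ZeroE) simp
qed

lemma repr_Succ: "repr Succ (\<lambda>xs y. case xs of [x] \<Rightarrow> is_succ N x y | _ \<Rightarrow> False)"
  unfolding repr_def dfnl_def
proof (intro conjI allI impI ballI)
  fix L t assume L: "dlist N L" and t: "dtm N t"
  from L show "dfn N (\<lambda>s. case L s of [x] \<Rightarrow> is_succ N x (t s) | _ \<Rightarrow> False)"
  proof (cases rule: dlist_cases)
    case 1 then show ?thesis by (simp add: dfn_const)
  next
    case (2 u L')
    from 2(2) show ?thesis
      by (cases rule: dlist_cases) (simp_all add: 2 t dfn_is_succ dfn_const)
  qed
next
  fix xs y v assume ev: "evaluates Succ xs y" and v: "v \<in> U"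
  from ev obtain x where x: "xs = [x]" "y = Suc x" by (rule evaluates_SuccE)
  show "(case map (num N) xs of [x] \<Rightarrow> is_succ N x v | _ \<Rightarrow> False) \<longleftrightarrow> v = num N y"
    using v by (simp add: x succ_num_iff)
qed

lemma repr_Proj: "repr (Proj i) (\<lambda>xs y. i < length xs \<and> y = xs ! i)"
  unfolding repr_def dfnl_def
proof (intro conjI allI impI ballI)
  fix L t assume L: "dlist N L" and t: "dtm N t"
  from L have len: "length (L s) = length (L s')" for s s' unfolding dlist_def by auto
  show "dfn N (\<lambda>s. i < length (L s) \<and> t s = L s ! i)"
  proof (cases "i < length (L undefined)")
    case True
    then have i: "i < length (L s)" for s using len[of s undefined] by simp
    show ?thesis by (simp add: i dfn_eq[OF t dlist_nth[OF L i]])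
  next
    case False
    then have i: "\<not> i < length (L s)" for s using len[of s undefined] by simp
    show ?thesis by (simp add: i dfn_const)
  qed
next
  fix xs y v assume ev: "evaluates (Proj i) xs y"
  then have "i < length xs" "y = xs ! i" by (auto elim: evaluates_ProjE)
  then show "(i < length (map (num N) xs) \<and> v = map (num N) xs ! i) \<longleftrightarrow> v = num N y" by simp
qed

text \<open>The tuple of intermediate values has standard length, so it can be quantified entry by
  entry. Each \<open>Rg i\<close> admits a single value in the whole domain, which forces the tuple
  to be the true one.\<close>

lemma repr_Comp:
  assumes f: "repr f Rf" and gs: "\<And>i. i < length gs \<Longrightarrow> repr (gs ! i) (Rg i)"
  shows "repr (Comp f gs) (\<lambda>xs y. \<exists>ys. length ys = length gs \<and> set ys \<subseteq> U \<and>
    ((\<forall>i<length gs. Rg i xs (ys ! i)) \<and> Rf ys y))"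
  unfolding repr_def dfnl_def
proof (intro conjI allI impI ballI)
  fix L t assume L: "dlist N L" and t: "dtm N t"
  show "dfn N (\<lambda>s. \<exists>ys. length ys = length gs \<and> set ys \<subseteq> U \<and>
    ((\<forall>i<length gs. Rg i (L s) (ys ! i)) \<and> Rf ys (t s)))"
  proof (rule dfn_ex_list)
    fix h :: "nat \<Rightarrow> nat" and L'
    assume L': "dlist N L'" "\<And>s. length (L' s) = length gs"
    show "dfn N (\<lambda>s. (\<forall>i<length gs. Rg i (L (\<lambda>k. s (h k))) (L' s ! i)) \<and>
      Rf (L' s) (t (\<lambda>k. s (h k))))"
    proof (rule dfn_conj)
      show "dfn N (\<lambda>s. Rf (L' s) (t (\<lambda>k. s (h k))))"
        by (rule repr_dfn[OF f L'(1) dtm_shift[OF t]])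
      show "dfn N (\<lambda>s. \<forall>i<length gs. Rg i (L (\<lambda>k. s (h k))) (L' s ! i))"
      proof (rule dfn_all_less)
        fix i assume i: "i < length gs"
        have "dtm N (\<lambda>s. L' s ! i)" by (rule dlist_nth[OF L'(1)]) (simp add: L'(2) i)
        then show "dfn N (\<lambda>s. Rg i (L (\<lambda>k. s (h k))) (L' s ! i))"
          by (rule repr_dfn[OF gs[OF i] dlist_shift[OF L]])
      qed
    qed
  qed
next
  fix xs z v assume ev: "evaluates (Comp f gs) xs z" and v: "v \<in> U"
  from ev obtain ys where ys: "list_all2 (\<lambda>g y. evaluates g xs y) gs ys" "evaluates f ys z"
    by (rule evaluates_CompE)
  have len: "length gs = length ys" and g: "\<And>i. i < length gs \<Longrightarrow> evaluates (gs ! i) xs (ys ! i)"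
    using ys(1) by (auto simp: list_all2_conv_all_nth)
  have Rg: "Rg i (map (num N) xs) u \<longleftrightarrow> u = num N (ys ! i)" if "i < length gs" "u \<in> U" for i u
    by (rule reprD[OF gs g]) (use that in simp_all)
  show "(\<exists>ys. length ys = length gs \<and> set ys \<subseteq> U \<and>
      ((\<forall>i<length gs. Rg i (map (num N) xs) (ys ! i)) \<and> Rf ys v)) \<longleftrightarrow> v = num N z" (is "?L \<longleftrightarrow> _")
  proof
    assume ?L
    then obtain us where us: "length us = length gs" "set us \<subseteq> U"
      "\<And>i. i < length gs \<Longrightarrow> Rg i (map (num N) xs) (us ! i)" "Rf us v" by blast
    have "us ! i = num N (ys ! i)" if "i < length gs" for i
    proof -
      have "us ! i \<in> U" using us(1,2) that nth_mem[of i us] by auto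
      then show ?thesis using us(3) Rg that by blast
    qed
    then have "us = map (num N) ys" by (intro nth_equalityI) (simp_all add: us(1) len)
    then show "v = num N z" using us(4) reprD[OF f ys(2) v] by simp
  next
    assume "v = num N z"
    then have "Rf (map (num N) ys) v" using reprD[OF f ys(2) v] by simp
    then show ?L
      by (intro exI[of _ "map (num N) ys"]) (auto simp: len[symmetric] Rg numU)
  qed
qed

text \<open>\<open>H\<close> is a table of the recursion, given as a relation. The guard
  \<open>r \<epsilon> w\<close> confines the clause to the values on which two tables are compared
  in \<open>finite_recursion\<close>.\<close>

definition rec_step where
  "rec_step Rf Rg zs H c v \<longleftrightarrow> c = num N 0 \<and> Rf zs v \<or>
    (\<exists>d\<in>U. is_succ N d c \<and> (\<exists>r\<in>U. r \<epsilon> w \<and> prel N H d r \<and> Rg (d # r # zs) v))"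

lemma dfn_rec_step:
  assumes "repr f Rf" "repr g Rg" "dlist N Z" "dtm N H" "dtm N c" "dtm N v"
  shows "dfn N (\<lambda>s. rec_step Rf Rg (Z s) (H s) (c s) (v s))"
  unfolding rec_step_def
  by (intro dfn_intros dfn_set_intros repr_dfn[OF assms(1)] repr_dfn[OF assms(2)]
      dlist_Cons dlist_shift[OF assms(3)] assms(4-6)[THEN dtm_shift] numU wU)

text \<open>The relation says that some computation table up to \<open>n\<close> ends in
  \<open>y\<close>. For standard \<open>n\<close>, induction in the metatheory shows that any table
  contains the true values, and \<open>finite_recursion\<close> provides a table.\<close>

lemma repr_Prec:
  assumes f: "repr f Rf" and g: "repr g Rg"
  shows "repr (Prec f g) (\<lambda>xs y. case xs of [] \<Rightarrow> False | n # zs \<Rightarrow>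
    \<exists>H\<in>U. (\<forall>c\<in>U. c \<epsilon> n \<or> c = n \<longrightarrow>
        (\<forall>v\<in>U. v \<epsilon> w \<longrightarrow> (prel N H c v \<longleftrightarrow> rec_step Rf Rg zs H c v))) \<and>
      y \<epsilon> w \<and> prel N H n y)"
  unfolding repr_def dfnl_def
proof (intro conjI allI impI ballI)
  fix L t assume L: "dlist N L" and t: "dtm N t"
  from L show "dfn N (\<lambda>s. case L s of [] \<Rightarrow> False | n # zs \<Rightarrow>
    \<exists>H\<in>U. (\<forall>c\<in>U. c \<epsilon> n \<or> c = n \<longrightarrow>
        (\<forall>v\<in>U. v \<epsilon> w \<longrightarrow> (prel N H c v \<longleftrightarrow> rec_step Rf Rg zs H c v))) \<and>
      t s \<epsilon> w \<and> prel N H n (t s))"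
  proof (cases rule: dlist_cases)
    case 1 then show ?thesis by (simp add: dfn_const)
  next
    case (2 u Z)
    show ?thesis
      unfolding 2(3) list.case
      by (intro dfn_intros dfn_set_intros dfn_rec_step[OF f g] dlist_shift[OF 2(2)]
          dtm_shift[OF t] dtm_shift[OF 2(1)] wU)
  qed
next
  fix xs y v assume ev: "evaluates (Prec f g) xs y" and v: "v \<in> U"
  obtain n zs where xs: "xs = n # zs" using ev by (cases rule: evaluates_PrecE) auto
  obtain val where val: "evaluates f zs (val 0)"
    "\<And>j. j < n \<Longrightarrow> evaluates g (j # val j # zs) (val (Suc j))" "val n = y"
    using evaluates_Prec_values[OF ev[unfolded xs]] by blast
  let ?zs = "map (num N) zs"
  have unique: "prel N H (num N n) u \<longleftrightarrow> u = num N y"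
    if H: "\<And>j u. j \<le> n \<Longrightarrow> u \<epsilon> w \<Longrightarrow> prel N H (num N j) u \<longleftrightarrow> rec_step Rf Rg ?zs H (num N j) u"
      and u: "u \<epsilon> w" for H u
  proof -
    have "\<forall>u. u \<epsilon> w \<longrightarrow> (prel N H (num N j) u \<longleftrightarrow> u = num N (val j))" if "j \<le> n" for j
      using that
    proof (induction j)
      case 0
      have "\<not> is_succ N d (num N 0)" if "d \<in> U" for d
        using succ_eq_num[OF that] by blast
      then have "rec_step Rf Rg ?zs H (num N 0) u \<longleftrightarrow> u = num N (val 0)" if "u \<epsilon> w" for u
        unfolding rec_step_def using reprD[OF f val(1) memU(1)[OF that]] by blast
      then show ?case using H[OF 0] by blast
    next
      case (Suc j)
      have IH: "prel N H (num N j) u \<longleftrightarrow> u = num N (val j)" if "u \<epsilon> w" for u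
        using Suc that by simp
      have "rec_step Rf Rg ?zs H (num N (Suc j)) u \<longleftrightarrow> u = num N (val (Suc j))" if u: "u \<epsilon> w" for u
      proof -
        have step: "Rg (num N j # num N (val j) # ?zs) u \<longleftrightarrow> u = num N (val (Suc j))"
          using reprD[OF g val(2)[of j] memU(1)[OF u]] Suc.prems by simp
        show ?thesis
        proof
          assume "rec_step Rf Rg ?zs H (num N (Suc j)) u"
          then obtain d r where d: "d \<in> U" "is_succ N d (num N (Suc j))"
            and r: "r \<epsilon> w" "prel N H d r" "Rg (d # r # ?zs) u"
            unfolding rec_step_def num_inject by blast
          from d have "d = num N j" by (rule succ_eq_num) simp
          then show "u = num N (val (Suc j))" using r IH step by blast
        next
          assume "u = num N (val (Suc j))"
          then have "Rg (num N j # num N (val j) # ?zs) u" using step by blast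
          then show "rec_step Rf Rg ?zs H (num N (Suc j)) u"
            unfolding rec_step_def using num_Suc[of j] numU num_w IH by blast
        qed
      qed
      then show ?case using H[OF Suc.prems] by blast
    qed
    then show ?thesis using u val(3) by blast
  qed
  show "(case map (num N) xs of [] \<Rightarrow> False | n # zs \<Rightarrow>
    \<exists>H\<in>U. (\<forall>c\<in>U. c \<epsilon> n \<or> c = n \<longrightarrow>
        (\<forall>v\<in>U. v \<epsilon> w \<longrightarrow> (prel N H c v \<longleftrightarrow> rec_step Rf Rg zs H c v))) \<and>
      v \<epsilon> w \<and> prel N H n v) \<longleftrightarrow> v = num N y" (is "?L \<longleftrightarrow> _")
  proof
    assume ?L
    then obtain H where H: "H \<in> U" "\<And>c v. c \<in> U \<Longrightarrow> c \<epsilon> num N n \<or> c = num N n \<Longrightarrow>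
        v \<in> U \<Longrightarrow> v \<epsilon> w \<Longrightarrow> prel N H c v \<longleftrightarrow> rec_step Rf Rg ?zs H c v"
        and v: "v \<epsilon> w" "prel N H (num N n) v"
      unfolding xs list.map list.case by blast
    have "prel N H (num N j) u \<longleftrightarrow> rec_step Rf Rg ?zs H (num N j) u" if "j \<le> n" "u \<epsilon> w" for j u
      by (rule H(2)[OF numU _ memU(1)[OF that(2)] that(2)])
        (use that(1) in \<open>auto simp: num_mem_num num_inject\<close>)
    from unique[OF this v(1)] show "v = num N y" using v(2) by blast
  next
    assume veq: "v = num N y"
    have zs: "dlist N (\<lambda>s. ?zs)"
      unfolding dlist_def by (rule exI[of _ "map (\<lambda>n s. num N n) zs"]) (auto simp: dtm_const numU)
    have "\<exists>F\<in>U. \<forall>j<Suc n. \<forall>v. v \<epsilon> w \<longrightarrow>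
      (prel N F (num N j) v \<longleftrightarrow> rec_step Rf Rg ?zs F (num N j) v)"
    proof (rule finite_recursion[OF wU])
      fix F t u assume "F \<in> U" "dtm N t" "dtm N u"
      then show "dfn N (\<lambda>s. rec_step Rf Rg ?zs F (t s) (u s))"
        by (intro dfn_rec_step[OF f g] zs dtm_const)
    next
      fix F F' c v
      assume agree: "\<And>d v. d \<epsilon> c \<Longrightarrow> v \<epsilon> w \<Longrightarrow> prel N F d v \<longleftrightarrow> prel N F' d v"
        and F: "rec_step Rf Rg ?zs F c v"
      have "prel N F' d r" if "d \<in> U" "is_succ N d c" "r \<epsilon> w" "prel N F d r" for d r
        using agree[of d r] mem_succ[OF that(1,2)] that(3,4) by blast
      then show "rec_step Rf Rg ?zs F' c v"
        using F unfolding rec_step_def by blast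
    qed
    then obtain H where H: "H \<in> U" "\<And>j u. j \<le> n \<Longrightarrow> u \<epsilon> w \<Longrightarrow>
      prel N H (num N j) u \<longleftrightarrow> rec_step Rf Rg ?zs H (num N j) u"
      unfolding less_Suc_eq_le by blast
    have "prel N H c u \<longleftrightarrow> rec_step Rf Rg ?zs H c u"
      if c: "c \<epsilon> num N n \<or> c = num N n" and u: "u \<epsilon> w" for c u
    proof -
      obtain j where "j \<le> n" "c = num N j" using c unfolding mem_num by (auto intro: less_imp_le)
      then show ?thesis using H(2) u by blast
    qed
    moreover have "prel N H (num N n) v" using unique[OF H(2)] num_w veq by blast
    ultimately show ?L
      unfolding xs list.map list.case using H(1) num_w veq by blast
  qed
qed

text \<open>A false candidate \<open>v\<close> above the true answer \<open>num N y\<close>,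
  nonstandard ones included, is refuted by its own last clause: this demands a successor as value at
  \<open>num N y\<close>, where the value is zero. By \<open>num_trichotomy\<close> only standard
  candidates up to \<open>y\<close> remain.\<close>

lemma repr_Mini:
  assumes f: "repr f R"
  shows "repr (Mini f) (\<lambda>xs y. y \<epsilon> w \<and> R (y # xs) (num N 0) \<and>
    (\<forall>k\<in>U. k \<epsilon> y \<longrightarrow> (\<exists>z\<in>U. \<exists>z'\<in>U. is_succ N z z' \<and> R (k # xs) z')))"
  unfolding repr_def dfnl_def
proof (intro conjI allI impI ballI)
  fix L t assume L: "dlist N L" and t: "dtm N t"
  show "dfn N (\<lambda>s. t s \<epsilon> w \<and> R (t s # L s) (num N 0) \<and>
    (\<forall>k\<in>U. k \<epsilon> t s \<longrightarrow> (\<exists>z\<in>U. \<exists>z'\<in>U. is_succ N z z' \<and> R (k # L s) z')))"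
    by (intro dfn_intros dfn_set_intros repr_dfn[OF f] dlist_Cons dlist_shift[OF L]
          dtm_shift[OF t] wU numU)
next
  fix xs y v assume ev: "evaluates (Mini f) xs y" and v: "v \<in> U"
  from ev have ev0: "evaluates f (y # xs) 0" and
    evS: "\<And>k. k < y \<Longrightarrow> \<exists>z. evaluates f (k # xs) (Suc z)"
    by (auto elim: evaluates_MiniE)
  have R0: "R (num N y # map (num N) xs) u \<longleftrightarrow> u = num N 0" if "u \<in> U" for u
    using reprD[OF f ev0 that] by simp
  have RS: "\<exists>z. \<forall>u\<in>U. R (num N k # map (num N) xs) u \<longleftrightarrow> u = num N (Suc z)" if k: "k < y" for k
  proof -
    obtain z where z: "evaluates f (k # xs) (Suc z)" using evS[OF k] by blast
    show ?thesis using reprD[OF f z] by (intro exI[of _ z]) simp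
  qed
  show "v \<epsilon> w \<and> R (v # map (num N) xs) (num N 0) \<and>
    (\<forall>k\<in>U. k \<epsilon> v \<longrightarrow> (\<exists>z\<in>U. \<exists>z'\<in>U. is_succ N z z' \<and> R (k # map (num N) xs) z'))
    \<longleftrightarrow> v = num N y" (is "?L \<longleftrightarrow> _")
  proof
    assume L: ?L
    have "\<not> num N y \<epsilon> v"
    proof
      assume "num N y \<epsilon> v"
      then obtain z z' where z: "z \<in> U" "z' \<in> U" "is_succ N z z'" "R (num N y # map (num N) xs) z'"
        using L numU by blast
      then have "z' = num N 0" using R0 by blast
      then show False using succ_eq_num[OF z(1)] z(3) by blast
    qed
    then obtain i where i: "i \<le> y" "v = num N i" using num_trichotomy L by blast
    have "\<not> i < y"
    proof
      assume "i < y"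
      from RS[OF this] obtain z where
        "\<forall>u\<in>U. R (num N i # map (num N) xs) u \<longleftrightarrow> u = num N (Suc z)" ..
      then have "num N 0 = num N (Suc z)" using L i(2) numU by blast
      then show False unfolding num_inject by simp
    qed
    then show "v = num N y" using i by simp
  next
    assume veq: "v = num N y"
    have "\<exists>z\<in>U. \<exists>z'\<in>U. is_succ N z z' \<and> R (k # map (num N) xs) z'" if k: "k \<epsilon> v" for k
    proof -
      obtain j where j: "j < y" "k = num N j" using k unfolding veq mem_num by metis
      from RS[OF j(1)] obtain z where
        "\<forall>u\<in>U. R (num N j # map (num N) xs) u \<longleftrightarrow> u = num N (Suc z)" ..
      then show ?thesis using j(2) num_Suc[of z] numU by blast
    qed
    then show ?L unfolding veq using num_w R0 numU by blast
  qed
qed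

lemma ex_repr: "\<exists>R. repr f R"
proof (induction f)
  case (Comp f gs)
  obtain Rf where "repr f Rf" using Comp.IH(1) by blast
  moreover have "\<forall>i. \<exists>R. i < length gs \<longrightarrow> repr (gs ! i) R" using Comp.IH(2) nth_mem by blast
  from choice[OF this] obtain Rg where "\<forall>i. i < length gs \<longrightarrow> repr (gs ! i) (Rg i)" ..
  ultimately show ?case using repr_Comp by blast
qed (use repr_Zero repr_Succ repr_Proj repr_Prec repr_Mini in blast)+

end

section \<open>A recursive definition of the Cantor pairing behind the codes\<close>

definition add_recf :: recf where
  "add_recf = Prec (Proj 0) (Comp Succ [Proj 1])"

definition triangle_recf :: recf where
  "triangle_recf = Prec Zero (Comp add_recf [Proj 1, Comp Succ [Proj 0]])"

text \<open>Computes \<open>triangle (m + n) + m\<close>, which is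
  \<open>prod_encode (m, n)\<close>.\<close>

definition pair_recf :: recf where
  "pair_recf = Comp add_recf [Comp triangle_recf [add_recf], Proj 0]"

lemma evaluates_Proj: "i < length xs \<Longrightarrow> y = xs ! i \<Longrightarrow> evaluates (Proj i) xs y"
  by (simp add: evaluates.proj)

lemma evaluates_Comp1:
  "evaluates g xs y \<Longrightarrow> evaluates f [y] z \<Longrightarrow> evaluates (Comp f [g]) xs z"
  by (rule evaluates.comp[where ys = "[y]"]) simp_all

lemma evaluates_Comp2:
  "evaluates g xs y \<Longrightarrow> evaluates g' xs y' \<Longrightarrow> evaluates f [y, y'] z \<Longrightarrow>
    evaluates (Comp f [g, g']) xs z"
  by (rule evaluates.comp[where ys = "[y, y']"]) simp_all

lemma evaluates_add: "evaluates add_recf [m, n] (m + n)"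
  unfolding add_recf_def
proof (induction m)
  case 0
  show ?case by (rule evaluates.prec_0) (simp add: evaluates_Proj)
next
  case (Suc m)
  have "evaluates (Comp Succ [Proj 1]) (m # (m + n) # [n]) (Suc (m + n))"
    by (rule evaluates_Comp1[OF evaluates_Proj evaluates.succ]) simp_all
  from evaluates.prec_Suc[OF Suc this] show ?case by simp
qed

lemma evaluates_triangle: "evaluates triangle_recf [n] (triangle n)"
  unfolding triangle_recf_def
proof (induction n)
  case 0
  show ?case using evaluates.prec_0[OF evaluates.zero] by simp
next
  case (Suc n)
  have S: "evaluates (Comp Succ [Proj 0]) (n # triangle n # []) (Suc n)"
    by (rule evaluates_Comp1[OF evaluates_Proj evaluates.succ]) simp_all
  have "evaluates (Comp add_recf [Proj 1, Comp Succ [Proj 0]]) (n # triangle n # []) (triangle n + Suc n)"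
    by (rule evaluates_Comp2[OF evaluates_Proj S evaluates_add]) simp_all
  from evaluates.prec_Suc[OF Suc this] show ?case by simp
qed

lemma evaluates_pair: "evaluates pair_recf [m, n] (prod_encode (m, n))"
  unfolding pair_recf_def prod_encode_def prod.case
  by (rule evaluates_Comp2[OF evaluates_Comp1[OF evaluates_add evaluates_triangle]
        evaluates_Proj evaluates_add]) simp_all

lemma le_triangle: "n \<le> triangle n"
  by (induction n) simp_all

text \<open>Makes codes of subformulas strictly smaller: the tags of \<open>Neg\<close>,
  \<open>Conj\<close> and \<open>All\<close> are positive, and the tag \<open>0\<close> belongs to
  \<open>Eq\<close>, which has no subformulas.\<close>

lemma less_prod_encode: "0 < a \<Longrightarrow> b < prod_encode (a, b)"
  using le_triangle[of "a + b"] by (simp add: prod_encode_def)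

section \<open>Satisfaction in a set structure\<close>

context zfc_omega
begin

text \<open>
  Assignments into \<open>m\<close> are elements of \<open>N\<close> that are total on the \<open>\<omega>\<close> of \<open>N\<close>, so that the same
  set serves standard and nonstandard variables.
\<close>

definition functional :: "'a \<Rightarrow> ('a \<Rightarrow> 'a \<Rightarrow> bool) \<Rightarrow> bool" where
  "functional m Q \<longleftrightarrow>
    (\<forall>i. i \<epsilon> w \<longrightarrow> (\<exists>x. x \<epsilon> m \<and> Q i x \<and> (\<forall>y. y \<epsilon> m \<longrightarrow> Q i y \<longrightarrow> y = x)))"

text \<open>The last clause is closure under definable functions. Constant assignments and updates
  are all obtained from it, without returning to the set that bounds \<open>A\<close>.\<close>

definition assignments :: "'a \<Rightarrow> 'a \<Rightarrow> bool" where
  "assignments m A \<longleftrightarrow> A \<in> U \<and> (\<forall>s. s \<epsilon> A \<longrightarrow> functional m (prel N s)) \<and>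
    (\<forall>Q. (\<forall>t u. dtm N t \<longrightarrow> dtm N u \<longrightarrow> dfn N (\<lambda>s. Q (t s) (u s))) \<longrightarrow> functional m Q \<longrightarrow>
      (\<exists>s. s \<epsilon> A \<and> (\<forall>i x. i \<epsilon> w \<longrightarrow> x \<epsilon> m \<longrightarrow> (prel N s i x \<longleftrightarrow> Q i x))))"

lemma ex_assignments:
  assumes m: "m \<in> U"
  shows "\<exists>A. assignments m A"
proof (rule rel_comprehension[OF wU m])
  fix B assume B: "B \<in> U" and
    rel: "\<And>Q. (\<And>t u. dtm N t \<Longrightarrow> dtm N u \<Longrightarrow> dfn N (\<lambda>s. Q (t s) (u s))) \<Longrightarrow>
      \<exists>F\<in>U. (\<forall>q. q \<epsilon> F \<longrightarrow> q \<epsilon> B) \<and>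
      (\<forall>c\<in>U. \<forall>v\<in>U. prel N F c v \<longleftrightarrow> c \<epsilon> w \<and> v \<epsilon> m \<and> Q c v)"
  \<comment> \<open>Since \<open>B\<close> bounds every definable relation between \<open>w\<close>
    and \<open>m\<close> at once, its power set has room for all assignments.\<close>
  obtain P where P: "P \<in> U" "\<And>u. u \<in> U \<Longrightarrow> u \<epsilon> P \<longleftrightarrow> (\<forall>v. v \<epsilon> u \<longrightarrow> v \<epsilon> B)"
    using ex_Pow[OF B] by blast
  \<comment> \<open>This is \<open>functional\<close> with its quantifiers relativised to
    \<open>U\<close>, the shape that the closure rules for definability accept.\<close>
  define Fn where "Fn s \<longleftrightarrow> (\<forall>i\<in>U. i \<epsilon> w \<longrightarrow> (\<exists>x\<in>U. x \<epsilon> m \<and> prel N s i x \<and>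
    (\<forall>y\<in>U. y \<epsilon> m \<longrightarrow> prel N s i y \<longrightarrow> y = x)))" for s
  have "dfn N (\<lambda>s. Fn (s 0))"
    unfolding Fn_def by (intro dfn_intros dfn_set_intros m wU)
  from sep[OF this P(1)] obtain A where A: "A \<in> U" "\<And>u. u \<epsilon> A \<longleftrightarrow> u \<epsilon> P \<and> Fn u" by blast
  show ?thesis
    unfolding assignments_def
  proof (rule exI[of _ A], intro conjI allI impI A(1))
    fix s assume s: "s \<epsilon> A"
    show "functional m (prel N s)"
      unfolding functional_def
    proof (intro allI impI)
      fix i assume i: "i \<epsilon> w"
      have "\<exists>x\<in>U. x \<epsilon> m \<and> prel N s i x \<and> (\<forall>y\<in>U. y \<epsilon> m \<longrightarrow> prel N s i y \<longrightarrow> y = x)"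
        using A(2)[of s] s i memU(1)[OF i] unfolding Fn_def by blast
      then obtain x where "x \<epsilon> m" "prel N s i x" "\<forall>y\<in>U. y \<epsilon> m \<longrightarrow> prel N s i y \<longrightarrow> y = x" by blast
      then show "\<exists>x. x \<epsilon> m \<and> prel N s i x \<and> (\<forall>y. y \<epsilon> m \<longrightarrow> prel N s i y \<longrightarrow> y = x)"
        using memU(1) by (intro exI[of _ x]) simp
    qed
  next
    fix Q assume Q: "\<forall>t u. dtm N t \<longrightarrow> dtm N u \<longrightarrow> dfn N (\<lambda>s. Q (t s) (u s))" and fn: "functional m Q"
    have "dfn N (\<lambda>s. Q (t s) (u s))" if "dtm N t" "dtm N u" for t u
      using Q that by blast
    from rel[of Q, OF this] obtain s where s: "s \<in> U" "\<forall>q. q \<epsilon> s \<longrightarrow> q \<epsilon> B"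
      "\<forall>c\<in>U. \<forall>v\<in>U. prel N s c v \<longleftrightarrow> c \<epsilon> w \<and> v \<epsilon> m \<and> Q c v" by blast
    have pr: "prel N s i x \<longleftrightarrow> Q i x" if "i \<epsilon> w" "x \<epsilon> m" for i x
      using s(3) that memU(1)[OF that(1)] memU(1)[OF that(2)] by blast
    have "Fn s"
      unfolding Fn_def
    proof (intro ballI impI)
      fix i assume i: "i \<epsilon> w"
      from fn i obtain x where x: "x \<epsilon> m" "Q i x" "\<forall>y. y \<epsilon> m \<longrightarrow> Q i y \<longrightarrow> y = x"
        unfolding functional_def by blast
      show "\<exists>x\<in>U. x \<epsilon> m \<and> prel N s i x \<and> (\<forall>y\<in>U. y \<epsilon> m \<longrightarrow> prel N s i y \<longrightarrow> y = x)"
      proof (intro bexI[of _ x] conjI ballI impI)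
        show "x \<in> U" "x \<epsilon> m" using x(1) memU(1) by blast+
        show "prel N s i x" using pr[OF i x(1)] x(2) by blast
        fix y assume "y \<epsilon> m" "prel N s i y"
        then show "y = x" using pr[OF i] x(3) by blast
      qed
    qed
    then have "s \<epsilon> A" unfolding A(2) P(2)[OF s(1)] using s(2) by blast
    then show "\<exists>s. s \<epsilon> A \<and> (\<forall>i x. i \<epsilon> w \<longrightarrow> x \<epsilon> m \<longrightarrow> (prel N s i x \<longleftrightarrow> Q i x))"
      using pr by (intro exI[of _ s]) simp
  qed
qed

end

locale set_structure = zfc_omega +
  fixes m e A Rp
  assumes mU: "m \<in> U" and eU: "e \<in> U" and A: "assignments m A"
    and repr_pair: "repr pair_recf Rp"
begin

lemma AU: "A \<in> U" using A unfolding assignments_def by blast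

lemma A_functional: "s \<epsilon> A \<Longrightarrow> functional m (prel N s)"
  using A unfolding assignments_def by blast

lemma A_fun:
  "s \<epsilon> A \<Longrightarrow> i \<epsilon> w \<Longrightarrow> \<exists>x. x \<epsilon> m \<and> prel N s i x \<and> (\<forall>y. y \<epsilon> m \<longrightarrow> prel N s i y \<longrightarrow> y = x)"
  using A_functional unfolding functional_def by blast

lemma A_ex:
  assumes "\<And>t u. dtm N t \<Longrightarrow> dtm N u \<Longrightarrow> dfn N (\<lambda>s. Q (t s) (u s))" "functional m Q"
  shows "\<exists>s. s \<epsilon> A \<and> (\<forall>i x. i \<epsilon> w \<longrightarrow> x \<epsilon> m \<longrightarrow> (prel N s i x \<longleftrightarrow> Q i x))"
  using A assms unfolding assignments_def by blast

section \<open>Assignments of \<open>N\<close> read from outside\<close>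

text \<open>Turns an internal assignment into one that \<open>sat\<close> can take, by evaluating it
  at the standard variables.\<close>

definition val :: "'a \<Rightarrow> nat \<Rightarrow> 'a" where
  "val s i = (THE x. x \<epsilon> m \<and> prel N s (num N i) x)"

lemma val:
  assumes s: "s \<epsilon> A"
  shows val_m: "val s i \<epsilon> m" and prel_iff_val: "x \<epsilon> m \<Longrightarrow> prel N s (num N i) x \<longleftrightarrow> x = val s i"
proof -
  obtain y where y: "y \<epsilon> m" "prel N s (num N i) y" "\<And>z. z \<epsilon> m \<Longrightarrow> prel N s (num N i) z \<Longrightarrow> z = y"
    using A_fun[OF s num_w] by blast
  have "val s i = y" unfolding val_def by (rule the_equality) (use y in blast)+
  then show "val s i \<epsilon> m" "x \<epsilon> m \<Longrightarrow> prel N s (num N i) x \<longleftrightarrow> x = val s i" using y by blast+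
qed

definition agree :: "'a \<Rightarrow> 'a \<Rightarrow> 'a \<Rightarrow> bool" where
  "agree t s c \<longleftrightarrow> (\<forall>i\<in>U. i \<epsilon> w \<longrightarrow> i \<noteq> c \<longrightarrow> (\<forall>y\<in>U. y \<epsilon> m \<longrightarrow> (prel N t i y \<longleftrightarrow> prel N s i y)))"

lemma dfn_agree:
  assumes "dtm N t" "dtm N u" "dtm N c"
  shows "dfn N (\<lambda>s. agree (t s) (u s) (c s))"
  unfolding agree_def by (intro dfn_intros dfn_set_intros assms[THEN dtm_shift] mU wU)

lemma agree_val:
  assumes "t \<epsilon> A" "s \<epsilon> A" "agree t s (num N j)"
  shows "val t = (val s)(j := val t j)"
proof
  fix i
  have "val t i = val s i" if "i \<noteq> j"
  proof -
    have "prel N t (num N i) (val t i) \<longleftrightarrow> prel N s (num N i) (val t i)"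
      using assms(3) that numU num_w val_m[OF assms(1)] memU(1)[OF val_m[OF assms(1)]]
      unfolding agree_def by (simp add: num_inject)
    then show ?thesis
      using prel_iff_val[OF assms(1) val_m[OF assms(1)]] prel_iff_val[OF assms(2) val_m[OF assms(1)]]
      by simp
  qed
  then show "val t i = ((val s)(j := val t j)) i" by simp
qed

lemma ex_update:
  assumes s: "s \<epsilon> A" and x: "x \<epsilon> m"
  obtains t where "t \<epsilon> A" "agree t s (num N j)" "val t = (val s)(j := x)"
proof -
  define Q where "Q i y \<longleftrightarrow> i \<noteq> num N j \<and> prel N s i y \<or> i = num N j \<and> y = x" for i y
  have "dfn N (\<lambda>v. Q (t v) (u v))" if "dtm N t" "dtm N u" for t u
    unfolding Q_def by (intro dfn_intros dfn_set_intros that numU memU(1)[OF x] memU(1)[OF s])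
  moreover have "functional m Q"
    unfolding functional_def
  proof (intro allI impI)
    fix i assume "i \<epsilon> w"
    then show "\<exists>x. x \<epsilon> m \<and> Q i x \<and> (\<forall>y. y \<epsilon> m \<longrightarrow> Q i y \<longrightarrow> y = x)"
      using A_fun[OF s, of i] x unfolding Q_def by (cases "i = num N j") auto
  qed
  ultimately have "\<exists>t. t \<epsilon> A \<and> (\<forall>i x. i \<epsilon> w \<longrightarrow> x \<epsilon> m \<longrightarrow> (prel N t i x \<longleftrightarrow> Q i x))"
    by (rule A_ex)
  then obtain t where t: "t \<epsilon> A" "\<And>i x. i \<epsilon> w \<Longrightarrow> x \<epsilon> m \<Longrightarrow> prel N t i x \<longleftrightarrow> Q i x" by blast
  have a: "agree t s (num N j)" unfolding agree_def by (simp add: t(2) Q_def)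
  have "val t j = x"
    using prel_iff_val[OF t(1) x, of j] t(2)[OF num_w x, of j] by (simp add: Q_def)
  then show thesis using that[OF t(1) a] agree_val[OF t(1) s a] by simp
qed

text \<open>Starts from the constant assignment with value \<open>d\<close> and updates it
  \<open>l\<close> times.\<close>

lemma ex_assignment:
  assumes "\<And>i. i < l \<Longrightarrow> \<rho> i \<epsilon> m" "d \<epsilon> m"
  shows "\<exists>s. s \<epsilon> A \<and> (\<forall>i<l. val s i = \<rho> i)"
  using assms(1)
proof (induction l)
  case 0
  have "\<exists>s. s \<epsilon> A \<and> (\<forall>i x. i \<epsilon> w \<longrightarrow> x \<epsilon> m \<longrightarrow> (prel N s i x \<longleftrightarrow> x = d))"
  proof (rule A_ex)
    fix t u assume "dtm N u"
    then show "dfn N (\<lambda>s. u s = d)" by (intro dfn_intros memU(1)[OF assms(2)])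
  qed (use assms(2) in \<open>auto simp: functional_def\<close>)
  then show ?case by blast
next
  case (Suc l)
  then obtain s where s: "s \<epsilon> A" "\<forall>i<l. val s i = \<rho> i" by auto
  obtain t where "t \<epsilon> A" "val t = (val s)(l := \<rho> l)"
    using ex_update[OF s(1), of "\<rho> l" l] Suc.prems by blast
  then show ?case using s(2) by (intro exI[of _ t]) (simp add: less_Suc_eq)
qed

text \<open>The bounds on \<open>x\<close> and \<open>y\<close> make the components of a standard code standard.\<close>

definition is_code :: "'a \<Rightarrow> 'a \<Rightarrow> 'a \<Rightarrow> bool" where
  "is_code x y z \<longleftrightarrow> (x \<epsilon> z \<or> x = z) \<and> (y \<epsilon> z \<or> y = z) \<and> Rp [x, y] z"

lemma dfn_is_code:
  assumes "dtm N x" "dtm N y" "dtm N z"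
  shows "dfn N (\<lambda>s. is_code (x s) (y s) (z s))"
  unfolding is_code_def
  by (intro dfn_intros repr_dfn[OF repr_pair] dlist_Cons dlist_Nil assms)

lemma is_code_num: "is_code x y (num N z) \<longleftrightarrow> (\<exists>a b. x = num N a \<and> y = num N b \<and> z = prod_encode (a, b))"
proof
  assume *: "is_code x y (num N z)"
  have "\<exists>a. u = num N a" if "u \<epsilon> num N z \<or> u = num N z" for u
    using that unfolding mem_num by auto
  then obtain a b where ab: "x = num N a" "y = num N b" using * unfolding is_code_def by metis
  then have "num N z = num N (prod_encode (a, b))"
    using * reprD[OF repr_pair evaluates_pair numU] unfolding is_code_def by simp
  then show "\<exists>a b. x = num N a \<and> y = num N b \<and> z = prod_encode (a, b)"
    using ab by (auto simp: num_inject)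
next
  assume "\<exists>a b. x = num N a \<and> y = num N b \<and> z = prod_encode (a, b)"
  then obtain a b where ab: "x = num N a" "y = num N b" "z = prod_encode (a, b)" by blast
  have "a \<le> z" "b \<le> z" unfolding ab(3) by (rule le_prod_encode_1, rule le_prod_encode_2)
  then show "is_code x y (num N z)"
    using reprD[OF repr_pair evaluates_pair numU, of a b z] unfolding is_code_def ab(1,2)
    by (auto simp: num_mem_num num_inject ab(3))
qed

text \<open>A standard code has only its true components, even among nonstandard candidates. As a
  rewrite rule this evaluates the decoding quantifiers in \<open>tarski\<close>.\<close>

lemma ex_is_code:
  "(\<exists>x\<in>U. \<exists>y\<in>U. is_code x y (num N (prod_encode (a, b))) \<and> X x y) \<longleftrightarrow> X (num N a) (num N b)"
  unfolding is_code_num by (auto simp: numU)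

text \<open>
  The restriction to codes in \<open>c\<close> is redundant for genuine formulas; it makes the clauses a
  recursion on \<open>c\<close> also when \<open>c\<close> codes no formula.
\<close>

definition tarski :: "'a \<Rightarrow> 'a \<Rightarrow> 'a \<Rightarrow> bool" where
  "tarski F c s \<longleftrightarrow> (\<exists>u\<in>U. \<exists>d\<in>U. is_code u d c \<and> (
     u = num N 0 \<and> (\<exists>i\<in>U. \<exists>j\<in>U. is_code i j d \<and>
       (\<exists>x\<in>U. x \<epsilon> m \<and> prel N s i x \<and> prel N s j x))
   \<or> u = num N 1 \<and> (\<exists>i\<in>U. \<exists>j\<in>U. is_code i j d \<and>
       (\<exists>x\<in>U. \<exists>y\<in>U. x \<epsilon> m \<and> y \<epsilon> m \<and> prel N s i x \<and> prel N s j y \<and> prel N e x y))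
   \<or> u = num N 2 \<and> d \<epsilon> c \<and> \<not> prel N F d s
   \<or> u = num N 3 \<and> (\<exists>i\<in>U. \<exists>j\<in>U. is_code i j d \<and>
       (i \<epsilon> c \<and> j \<epsilon> c \<and> prel N F i s \<and> prel N F j s))
   \<or> u = num N 4 \<and> (\<exists>i\<in>U. \<exists>j\<in>U. is_code i j d \<and>
       (j \<epsilon> c \<and> (\<forall>t\<in>U. t \<epsilon> A \<longrightarrow> agree t s i \<longrightarrow> prel N F j t)))))"

lemma dfn_tarski:
  assumes "dtm N F" "dtm N c" "dtm N t"
  shows "dfn N (\<lambda>s. tarski (F s) (c s) (t s))"
  unfolding tarski_def
  by (intro dfn_intros dfn_set_intros dfn_is_code dfn_agree assms[THEN dtm_shift] mU eU AU numU)

text \<open>Each appeal to \<open>F\<close> is guarded by membership of its code in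
  \<open>c\<close>. This is the locality that \<open>finite_recursion\<close> asks for.\<close>

lemma tarski_mono:
  assumes "\<And>d v. d \<epsilon> c \<Longrightarrow> v \<epsilon> A \<Longrightarrow> prel N F d v \<longleftrightarrow> prel N F' d v" "s \<epsilon> A"
  shows "tarski F c s \<longleftrightarrow> tarski F' c s"
proof -
  have "d \<epsilon> c \<and> \<not> prel N F d s \<longleftrightarrow> d \<epsilon> c \<and> \<not> prel N F' d s"
    "i \<epsilon> c \<and> d \<epsilon> c \<and> prel N F i s \<and> prel N F d s \<longleftrightarrow> i \<epsilon> c \<and> d \<epsilon> c \<and> prel N F' i s \<and> prel N F' d s"
    "d \<epsilon> c \<and> (\<forall>t\<in>U. t \<epsilon> A \<longrightarrow> agree t s i \<longrightarrow> prel N F d t) \<longleftrightarrow>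
     d \<epsilon> c \<and> (\<forall>t\<in>U. t \<epsilon> A \<longrightarrow> agree t s i \<longrightarrow> prel N F' d t)" for d i
    using assms by blast+
  then show ?thesis unfolding tarski_def by (simp only:)
qed

lemma ex_satisfaction:
  "\<exists>F\<in>U. \<forall>j<n. \<forall>s. s \<epsilon> A \<longrightarrow> (prel N F (num N j) s \<longleftrightarrow> tarski F (num N j) s)"
proof (rule finite_recursion[OF AU])
  fix F t u assume "F \<in> U" "dtm N t" "dtm N u"
  then show "dfn N (\<lambda>s. tarski F (t s) (u s))" by (intro dfn_tarski dtm_const)
next
  fix F F' c v
  assume "v \<epsilon> A" "\<And>d v. d \<epsilon> c \<Longrightarrow> v \<epsilon> A \<Longrightarrow> prel N F d v \<longleftrightarrow> prel N F' d v" "tarski F c v"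
  then show "tarski F' c v" using tarski_mono[of c F F' v] by blast
qed

abbreviation "D \<equiv> extern N m e"

lemma domD: "x \<in> dom D \<longleftrightarrow> x \<epsilon> m"
  unfolding extern_def using memU(1) by auto

lemma memD: "x \<epsilon> m \<Longrightarrow> y \<epsilon> m \<Longrightarrow> mem D x y \<longleftrightarrow> prel N e x y"
  unfolding extern_def prel_def using memU(1)[of x m] memU(1)[of y m] by simp

lemma satisfaction_correct:
  assumes "\<And>n s. n \<le> godel \<phi> \<Longrightarrow> s \<epsilon> A \<Longrightarrow> prel N F (num N n) s \<longleftrightarrow> tarski F (num N n) s"
    and s: "s \<epsilon> A"
  shows "prel N F (num N (godel \<phi>)) s \<longleftrightarrow> sat D (val s) \<phi>"
  using assms
proof (induction \<phi> arbitrary: s)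
  case (Eq i j)
  have "(\<exists>x\<in>U. x \<epsilon> m \<and> prel N s (num N i) x \<and> prel N s (num N j) x) \<longleftrightarrow> val s i = val s j"
    using val_m[OF Eq.prems(2)] prel_iff_val[OF Eq.prems(2)] memU(1) by metis
  then show ?case
    unfolding Eq.prems(1)[OF order_refl Eq.prems(2)] unfolding godel.simps tarski_def ex_is_code num_inject
    by simp
next
  case (Mem i j)
  have "(\<exists>x\<in>U. \<exists>y\<in>U. x \<epsilon> m \<and> y \<epsilon> m \<and> prel N s (num N i) x \<and> prel N s (num N j) y \<and> prel N e x y)
    \<longleftrightarrow> prel N e (val s i) (val s j)"
    using val_m[OF Mem.prems(2)] prel_iff_val[OF Mem.prems(2)] memU(1) by metis
  then show ?case
    unfolding Mem.prems(1)[OF order_refl Mem.prems(2)]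
    unfolding godel.simps tarski_def ex_is_code num_inject
    by (simp add: memD val_m[OF Mem.prems(2)])
next
  case (Neg \<phi>)
  have lt: "godel \<phi> < godel (Neg \<phi>)" by (simp add: less_prod_encode)
  have IH: "prel N F (num N (godel \<phi>)) s \<longleftrightarrow> sat D (val s) \<phi>"
    by (rule Neg.IH) (use Neg.prems lt in auto)
  show ?case
    unfolding Neg.prems(1)[OF order_refl Neg.prems(2)] using lt
    unfolding godel.simps tarski_def ex_is_code num_inject num_mem_num
    by (simp add: IH)
next
  case (Conj \<phi> \<psi>)
  have "godel \<phi> \<le> prod_encode (godel \<phi>, godel \<psi>)" "godel \<psi> \<le> prod_encode (godel \<phi>, godel \<psi>)"
    by (rule le_prod_encode_1, rule le_prod_encode_2)
  then have lt: "godel \<phi> < godel (Conj \<phi> \<psi>)" "godel \<psi> < godel (Conj \<phi> \<psi>)"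
    using less_prod_encode[of 3 "prod_encode (godel \<phi>, godel \<psi>)"] by simp_all
  have IH: "prel N F (num N (godel \<phi>)) s \<longleftrightarrow> sat D (val s) \<phi>"
    by (rule Conj.IH) (use Conj.prems lt in auto)
  have IH2: "prel N F (num N (godel \<psi>)) s \<longleftrightarrow> sat D (val s) \<psi>"
    by (rule Conj.IH) (use Conj.prems lt in auto)
  show ?case
    unfolding Conj.prems(1)[OF order_refl Conj.prems(2)] using lt
    unfolding godel.simps tarski_def ex_is_code num_inject num_mem_num
    by (simp add: IH IH2)
next
  case (All i \<phi>)
  have "godel \<phi> \<le> prod_encode (i, godel \<phi>)"
    by (rule le_prod_encode_2)
  then have lt: "godel \<phi> < godel (All i \<phi>)"
    using less_prod_encode[of 4 "prod_encode (i, godel \<phi>)"] by simp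
  have IH: "prel N F (num N (godel \<phi>)) t \<longleftrightarrow> sat D (val t) \<phi>" if "t \<epsilon> A" for t
    by (rule All.IH) (use All.prems(1) that lt in auto)
  \<comment> \<open>Varying the assignment off which only \<open>i\<close> is fixed amounts to
    varying the value at \<open>i\<close>: \<open>ex_update\<close> realises every value, and
    \<open>agree_val\<close> shows that nothing else changes at standard variables.\<close>
  have "(\<forall>t\<in>U. t \<epsilon> A \<longrightarrow> agree t s (num N i) \<longrightarrow> prel N F (num N (godel \<phi>)) t) \<longleftrightarrow>
    (\<forall>x\<in>dom D. sat D ((val s)(i := x)) \<phi>)" (is "?L \<longleftrightarrow> ?R")
  proof
    assume L: ?L
    show ?R
    proof
      fix x assume "x \<in> dom D"
      then have "x \<epsilon> m" by (simp add: domD)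
      then obtain t where t: "t \<epsilon> A" "agree t s (num N i)" "val t = (val s)(i := x)"
        using ex_update[OF All.prems(2)] by metis
      then have "sat D (val t) \<phi>" using L IH[OF t(1)] memU(1)[OF t(1)] by simp
      then show "sat D ((val s)(i := x)) \<phi>" unfolding t(3) .
    qed
  next
    assume R: ?R
    show ?L
    proof (intro ballI impI)
      fix t assume t: "t \<epsilon> A" "agree t s (num N i)"
      have "sat D ((val s)(i := val t i)) \<phi>" using R val_m[OF t(1)] domD by blast
      then show "prel N F (num N (godel \<phi>)) t"
        unfolding IH[OF t(1)] agree_val[OF t(1) All.prems(2) t(2), symmetric] .
    qed
  qed
  then show ?case
    unfolding All.prems(1)[OF order_refl All.prems(2)] using lt
    unfolding godel.simps tarski_def ex_is_code num_inject num_mem_num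
    by simp
qed

end

section \<open>Saturation\<close>

lemma (in set_structure) extern_saturated:
  assumes k0: "k0 \<epsilon> w" "\<And>n. k0 \<noteq> num N n" and d: "d \<epsilon> m"
  shows "computably_saturated D"
  unfolding computably_saturated_def
proof (intro allI impI, elim conjE)
  fix a n p
  assume a: "set a \<subseteq> dom D" and fv: "\<forall>\<phi>\<in>p. fv \<phi> \<subseteq> {..<length a + n}"
    and comp: "computable (godel ` p)" and fin: "finitely_realizable D a n p"
  obtain f where f: "\<And>c. evaluates f [c] (if c \<in> godel ` p then 1 else 0)"
    using comp unfolding computable_def by blast
  obtain R where R: "repr f R" using ex_repr by blast
  have R_num: "R [num N c] (num N 1) \<longleftrightarrow> c \<in> godel ` p" for c
    using reprD[OF R f numU, of c 1] by (auto simp: num_inject)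
  have a_m: "a ! i \<epsilon> m" if "i < length a" for i
    using a nth_mem[OF that] domD by blast
  \<comment> \<open>The equation \<open>R [c] (num N 1)\<close> plays the part of membership in the
    type. The tuple \<open>a\<close> enters through finitely many conditions on \<open>s\<close>, so
    \<open>P\<close> remains definable with parameters.\<close>
  define P where "P k \<longleftrightarrow> (\<exists>F\<in>U.
      (\<forall>c\<in>U. c \<epsilon> k \<longrightarrow> (\<forall>s\<in>U. s \<epsilon> A \<longrightarrow> (prel N F c s \<longleftrightarrow> tarski F c s))) \<and>
      (\<exists>s\<in>U. s \<epsilon> A \<and> (\<forall>i<length a. prel N s (num N i) (a ! i)) \<and>
        (\<forall>c\<in>U. c \<epsilon> k \<longrightarrow> R [c] (num N 1) \<longrightarrow> prel N F c s)))" for k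
  have "dfn N (\<lambda>s. P (s 0))"
    unfolding P_def
    by (intro dfn_intros dfn_set_intros dfn_tarski repr_dfn[OF R] dlist_Cons dlist_Nil
        dfn_all_less AU numU memU(1)[OF a_m])
  moreover have "P (num N l)" for l
  proof -
    \<comment> \<open>Only finitely many codes lie below \<open>l\<close>; choosing one formula of
      \<open>p\<close> for each gives a finite part to which finite realizability applies.\<close>
    have "{j \<in> godel ` p. j < l} \<subseteq> godel ` p" "finite {j \<in> godel ` p. j < l}" by auto
    then obtain q where q: "q \<subseteq> p" "finite q" "{j \<in> godel ` p. j < l} = godel ` q"
      by (meson finite_subset_image)
    have "realizable D a n q" using fin q(1,2) unfolding finitely_realizable_def by simp
    then obtain b where b: "length b = n" "set b \<subseteq> dom D" "\<forall>\<phi>\<in>q. sat D (nth (a @ b)) \<phi>"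
      unfolding realizable_def realizes_def by (elim exE conjE)
    have "(a @ b) ! i \<epsilon> m" if "i < length a + n" for i
      using nth_mem[of i "a @ b"] a b(1,2) that domD by auto
    from ex_assignment[where \<rho> = "nth (a @ b)", OF this d] obtain s where
      s: "s \<epsilon> A" "\<And>i. i < length a + n \<Longrightarrow> val s i = (a @ b) ! i" by blast
    obtain F where F: "F \<in> U" "\<And>j s. j < l \<Longrightarrow> s \<epsilon> A \<Longrightarrow> prel N F (num N j) s \<longleftrightarrow> tarski F (num N j) s"
      using ex_satisfaction[of l] by blast
    show ?thesis
      unfolding P_def
    proof (rule bexI[OF _ F(1)], rule conjI)
      show "\<forall>c\<in>U. c \<epsilon> num N l \<longrightarrow> (\<forall>s\<in>U. s \<epsilon> A \<longrightarrow> (prel N F c s \<longleftrightarrow> tarski F c s))"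
      proof (intro ballI impI)
        fix c t assume "c \<epsilon> num N l" and t: "t \<epsilon> A"
        then obtain j where "j < l" "c = num N j" unfolding mem_num by blast
        then show "prel N F c t \<longleftrightarrow> tarski F c t" using F(2) t by blast
      qed
      show "\<exists>s\<in>U. s \<epsilon> A \<and> (\<forall>i<length a. prel N s (num N i) (a ! i)) \<and>
        (\<forall>c\<in>U. c \<epsilon> num N l \<longrightarrow> R [c] (num N 1) \<longrightarrow> prel N F c s)"
      proof (intro bexI[of _ s] conjI ballI impI allI)
        show "s \<epsilon> A" "s \<in> U" using s(1) memU(1) by blast+
      next
        fix i assume i: "i < length a"
        then show "prel N s (num N i) (a ! i)"
          using prel_iff_val[OF s(1) a_m[OF i]] s(2)[of i] by (simp add: nth_append)
      next
        fix c assume "c \<epsilon> num N l" and Rc: "R [c] (num N 1)"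
        then obtain j where j: "j < l" "c = num N j" unfolding mem_num by blast
        then have "j \<in> godel ` q" using Rc R_num q(3) by blast
        then obtain \<phi> where \<phi>: "\<phi> \<in> q" "j = godel \<phi>" by blast
        have "prel N F (num N (godel \<phi>)) s \<longleftrightarrow> sat D (val s) \<phi>"
          by (rule satisfaction_correct[OF F(2) s(1)]) (use j \<phi> in simp_all)
        moreover have "sat D (val s) \<phi> \<longleftrightarrow> sat D (nth (a @ b)) \<phi>"
          by (rule sat_cong, rule s(2)) (use fv \<phi>(1) q(1) in auto)
        ultimately show "prel N F c s" using bspec[OF b(3) \<phi>(1)] j(2) \<phi>(2) by simp
      qed
    qed
  qed
  ultimately obtain k where k: "k \<epsilon> w" "\<And>n. k \<noteq> num N n" "P k"
    using overspill[of P, OF _ _ k0] by blast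
  \<comment> \<open>One nonstandard bound exceeds all standard codes, so a single \<open>F\<close>
    and a single \<open>s\<close> serve every formula of \<open>p\<close>.\<close>
  have num_k: "num N j \<epsilon> k" for j by (rule nonstandard_above[OF k(1,2)])
  from k(3) obtain F s where F0:
      "\<forall>c\<in>U. c \<epsilon> k \<longrightarrow> (\<forall>s\<in>U. s \<epsilon> A \<longrightarrow> (prel N F c s \<longleftrightarrow> tarski F c s))"
    and s0: "s \<epsilon> A" "\<forall>i<length a. prel N s (num N i) (a ! i)"
      "\<forall>c\<in>U. c \<epsilon> k \<longrightarrow> R [c] (num N 1) \<longrightarrow> prel N F c s"
    unfolding P_def by (elim bexE conjE)
  have F: "prel N F c s \<longleftrightarrow> tarski F c s" if "c \<epsilon> k" "s \<epsilon> A" for c s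
    using F0 that memU(1)[OF that(1)] memU(1)[OF that(2)] by blast
  have s: "s \<epsilon> A" "\<And>i. i < length a \<Longrightarrow> prel N s (num N i) (a ! i)" using s0 by blast+
  have p: "prel N F c s" if "c \<epsilon> k" "R [c] (num N 1)" for c
    using s0(3) that memU(1)[OF that(1)] by blast
  \<comment> \<open>The type reserves the variables from \<open>length a\<close> on for the new
    tuple, so the solution is read off \<open>s\<close> there.\<close>
  define b where "b = map (\<lambda>i. val s (length a + i)) [0..<n]"
  have nth_ab: "(a @ b) ! i = val s i" if "i < length a + n" for i
    using that prel_iff_val[OF s(1) a_m, of i] s(2)[of i] by (auto simp: nth_append b_def)
  show "realizable D a n p"
    unfolding realizable_def realizes_def
  proof (intro exI[of _ b] conjI ballI)
    show "length b = n" by (simp add: b_def)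
    show "set b \<subseteq> dom D" using val_m[OF s(1)] domD by (auto simp: b_def)
    fix \<phi> assume \<phi>: "\<phi> \<in> p"
    then have "prel N F (num N (godel \<phi>)) s" using p[OF num_k] R_num by blast
    then have "sat D (val s) \<phi>"
      using satisfaction_correct[OF F[OF num_k] s(1)] by blast
    moreover have "sat D (nth (a @ b)) \<phi> \<longleftrightarrow> sat D (val s) \<phi>"
      by (rule sat_cong, rule nth_ab) (use fv \<phi> in auto)
    ultimately show "sat D (nth (a @ b)) \<phi>" by blast
  qed
qed

section \<open>Transfer along isomorphisms\<close>

locale structure_iso =
  fixes A :: "'a struct" and B :: "'b struct" and f
  assumes bij: "bij_betw f (dom A) (dom B)"
    and iso: "\<And>x y. x \<in> dom A \<Longrightarrow> y \<in> dom A \<Longrightarrow> mem B (f x) (f y) \<longleftrightarrow> mem A x y"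
begin

lemma image: "dom B = f ` dom A"
  using bij by (simp add: bij_betw_def)

lemma f_eq: "x \<in> dom A \<Longrightarrow> y \<in> dom A \<Longrightarrow> f x = f y \<longleftrightarrow> x = y"
  using bij by (auto simp: bij_betw_def inj_on_def)

text \<open>The domain condition is placed on free variables only, since \<open>nth (a @ b)\<close>
  is unspecified past the end of the list.\<close>

lemma sat_iso:
  "(\<And>i. i \<in> fv \<phi> \<Longrightarrow> s i \<in> dom A) \<Longrightarrow> sat B (\<lambda>i. f (s i)) \<phi> \<longleftrightarrow> sat A s \<phi>"
proof (induction \<phi> arbitrary: s)
  case (All i \<phi>)
  have "sat B ((\<lambda>i. f (s i))(i := f x)) \<phi> \<longleftrightarrow> sat A (s(i := x)) \<phi>" if "x \<in> dom A" for x
  proof -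
    have "sat B (\<lambda>j. f ((s(i := x)) j)) \<phi> \<longleftrightarrow> sat A (s(i := x)) \<phi>"
      by (rule All.IH) (use All.prems that in auto)
    moreover have "(\<lambda>j. f ((s(i := x)) j)) = (\<lambda>i. f (s i))(i := f x)" by auto
    ultimately show ?thesis by simp
  qed
  then show ?case by (simp add: image)
qed (auto simp: f_eq iso)

lemma computably_saturated_iso:
  assumes "computably_saturated A"
  shows "computably_saturated B"
  unfolding computably_saturated_def
proof (intro allI impI, elim conjE)
  fix a n p
  assume a: "set a \<subseteq> dom B" and fv: "\<forall>\<phi>\<in>p. fv \<phi> \<subseteq> {..<length a + n}"
    and comp: "computable (godel ` p)" and fin: "finitely_realizable B a n p"
  have lift: "\<exists>us. set us \<subseteq> dom A \<and> map f us = vs" if "set vs \<subseteq> dom B" for vs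
    using that unfolding image
    by (intro exI[of _ "map (inv_into (dom A) f) vs"])
      (auto intro: inv_into_into map_idI simp: f_inv_into_f subset_eq)
  obtain a' where a': "set a' \<subseteq> dom A" "map f a' = a" using lift[OF a] by blast
  have sat: "sat B (nth (a @ map f b)) \<phi> \<longleftrightarrow> sat A (nth (a' @ b)) \<phi>"
    if "set b \<subseteq> dom A" "length b = n" "\<phi> \<in> p" for b \<phi>
  proof -
    have fv\<phi>: "i < length (a' @ b)" if "i \<in> fv \<phi>" for i
      using subsetD[OF bspec[OF fv \<open>\<phi> \<in> p\<close>] that] \<open>length b = n\<close> a'(2) by auto
    have "sat B (nth (a @ map f b)) \<phi> \<longleftrightarrow> sat B (\<lambda>i. f ((a' @ b) ! i)) \<phi>"
    proof (rule sat_cong)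
      fix i assume "i \<in> fv \<phi>"
      then show "(a @ map f b) ! i = f ((a' @ b) ! i)"
        using fv\<phi>[of i] unfolding a'(2)[symmetric] map_append[symmetric] by (simp only: nth_map)
    qed
    also have "\<dots> \<longleftrightarrow> sat A (nth (a' @ b)) \<phi>"
    proof (rule sat_iso)
      fix i assume "i \<in> fv \<phi>"
      then have "(a' @ b) ! i \<in> set (a' @ b)" using fv\<phi> nth_mem by blast
      then show "(a' @ b) ! i \<in> dom A" using a'(1) that(1) by auto
    qed
    finally show ?thesis .
  qed
  have "finitely_realizable A a' n p"
    unfolding finitely_realizable_def
  proof (intro allI impI)
    fix q assume q: "finite q \<and> q \<subseteq> p"
    then obtain b where b: "length b = n" "set b \<subseteq> dom B" "realizes B a b q"
      using fin unfolding finitely_realizable_def realizable_def by blast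
    obtain b' where b': "set b' \<subseteq> dom A" "map f b' = b" using lift[OF b(2)] by blast
    have len: "length b' = n" using b(1) b'(2) by auto
    have "realizes A a' b' q"
      unfolding realizes_def
    proof
      fix \<phi> assume "\<phi> \<in> q"
      then show "sat A (nth (a' @ b')) \<phi>"
        using sat[OF b'(1) len, of \<phi>] b(3) q unfolding b'(2) realizes_def by blast
    qed
    then show "realizable A a' n q" unfolding realizable_def using b'(1) len by blast
  qed
  moreover have "length a' = length a" using a'(2) by auto
  ultimately have "realizable A a' n p"
    using assms a'(1) fv comp unfolding computably_saturated_def by metis
  then obtain b where b: "length b = n" "set b \<subseteq> dom A" "realizes A a' b p"
    unfolding realizable_def by blast
  have "realizes B a (map f b) p"
    using b(3) sat[OF b(2,1)] unfolding realizes_def by blast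
  moreover have "set (map f b) \<subseteq> dom B" using b(2) image by auto
  ultimately show "realizable B a n p"
    unfolding realizable_def using b(1) by (intro exI[of _ "map f b"]) simp
qed

lemma is_inductive_iso: "v \<in> dom A \<Longrightarrow> is_inductive B (f v) \<longleftrightarrow> is_inductive A v"
  unfolding is_inductive_def is_empty_def is_succ_def image
  by (simp add: iso f_eq)

lemma is_omega_iso:
  assumes "is_omega A w" shows "is_omega B (f w)"
proof -
  have w: "w \<in> dom A" "is_inductive A w"
    "\<forall>v\<in>dom A. is_inductive A v \<longrightarrow> (\<forall>x\<in>dom A. mem A x w \<longrightarrow> mem A x v)"
    using assms unfolding is_omega_def by blast+
  have "mem B (f x) (f v)"
    if "v \<in> dom A" "is_inductive B (f v)" "x \<in> dom A" "mem B (f x) (f w)" for v x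
    using that w(1,3) is_inductive_iso[OF that(1)] iso[OF that(3,1)] iso[OF that(3) w(1)] by blast
  then have "\<forall>v\<in>dom B. is_inductive B v \<longrightarrow> (\<forall>x\<in>dom B. mem B x (f w) \<longrightarrow> mem B x v)"
    unfolding image by blast
  moreover have "f w \<in> dom B" using w(1) image by blast
  moreover have "is_inductive B (f w)" using w(2) is_inductive_iso[OF w(1)] by blast
  ultimately show ?thesis unfolding is_omega_def by blast
qed

end

section \<open>Consequences of the Wellfoundedness Mirage\<close>

lemma thinks_omega_illfounded_nonstandard:
  assumes M: "zfc_model M" and rep: "represents N m e M" and ill: "thinks_omega_illfounded N m e"
  obtains w k where "is_omega M w" "mem M k w" "\<And>n. k \<noteq> num M n"
proof -
  obtain f where "bij_betw f (dom (extern N m e)) (dom M)"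
    "\<forall>x\<in>dom (extern N m e). \<forall>y\<in>dom (extern N m e). mem (extern N m e) x y \<longleftrightarrow> mem M (f x) (f y)"
    using rep unfolding represents_def isomorphic_def by blast
  then interpret structure_iso "extern N m e" M f by unfold_locales blast+
  obtain v S where v: "is_omega (extern N m e) v" and S: "\<exists>x\<in>dom N. mem N x S"
    "\<And>x. x \<in> dom N \<Longrightarrow> mem N x S \<Longrightarrow> mem N x m \<and> mem (extern N m e) x v"
    "\<And>x. x \<in> dom N \<Longrightarrow> mem N x S \<Longrightarrow> \<exists>y\<in>dom N. mem N y S \<and> mem (extern N m e) y x"
    using ill unfolding thinks_omega_illfounded_def by blast
  have vdom: "v \<in> dom (extern N m e)" using v unfolding is_omega_def by blast
  interpret zfc_omega M "f v"
    by unfold_locales (rule M, rule is_omega_iso[OF v])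
  \<comment> \<open>\<open>S\<close> is an element of \<open>N\<close>; carried over to
    \<open>M\<close>, its extension is merely an external subset of the omega of \<open>M\<close>.
    Foundation in \<open>M\<close> is not contradicted.\<close>
  define T where "T = {x \<in> dom N. mem N x S}"
  have T: "x \<in> dom (extern N m e)" if "x \<in> T" for x
    using S(2) that unfolding T_def extern_def by simp
  have "\<exists>k. mem M k (f v) \<and> (\<forall>n. k \<noteq> num M n)"
  proof (rule ex_nonstandard[of "f ` T"])
    show "f ` T \<noteq> {}" using S(1) unfolding T_def by blast
  next
    fix x assume "x \<in> f ` T"
    then obtain u where u: "u \<in> T" "x = f u" by blast
    then show "mem M x (f v)" using iso[OF T[OF u(1)] vdom] S(2)[of u] unfolding T_def by blast
  next
    fix x assume "x \<in> f ` T"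
    then obtain u where u: "u \<in> T" "x = f u" by blast
    then obtain y where y: "y \<in> T" "mem (extern N m e) y u" using S(3)[of u] unfolding T_def by blast
    then show "\<exists>y\<in>f ` T. mem M y x" using iso[OF T[OF y(1)] T[OF u(1)]] u(2) by blast
  qed
  then show thesis using that is_omega_iso[OF v] by blast
qed

lemma represents_computably_saturated:
  assumes N: "zfc_model N" and w: "is_omega N w" "mem N k w" "\<And>n. k \<noteq> num N n"
    and rep: "represents N m e M" and M: "dom M \<noteq> {}"
  shows "computably_saturated M"
proof -
  have me: "m \<in> dom N" "e \<in> dom N" using rep unfolding represents_def by blast+
  obtain f where "bij_betw f (dom (extern N m e)) (dom M)"
    "\<forall>x\<in>dom (extern N m e). \<forall>y\<in>dom (extern N m e). mem (extern N m e) x y \<longleftrightarrow> mem M (f x) (f y)"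
    using rep unfolding represents_def isomorphic_def by blast
  then interpret structure_iso "extern N m e" M f by unfold_locales blast+
  interpret zfc_omega N w by unfold_locales (rule N, rule w(1))
  obtain A Rp where "assignments m A" "repr pair_recf Rp"
    using ex_assignments[OF me(1)] ex_repr by blast
  then interpret set_structure N w m e A Rp using me by unfold_locales
  obtain d where "d \<epsilon> m" using M image domD by blast
  then have "computably_saturated (extern N m e)" by (rule extern_saturated[OF w(2,3)])
  then show ?thesis by (rule computably_saturated_iso)
qed

theorem mainTheorem2:
  fixes \<M> :: "'a struct set"
  assumes "multiverse \<M>"
    and "wellfoundedness_mirage \<M>"
  shows "\<forall>M\<in>\<M>. zfc_model M \<and> computably_saturated M"
proof
  fix M assume M: "M \<in> \<M>"
  have zfc: "zfc_model M" if "M \<in> \<M>" for M using assms(1) that unfolding multiverse_def by blast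
  obtain N m e where N: "N \<in> \<M>" "represents N m e M"
    using assms(2) M unfolding wellfoundedness_mirage_def by blast
  obtain K a b where K: "K \<in> \<M>" "represents K a b N" "thinks_omega_illfounded K a b"
    using assms(2) N(1) unfolding wellfoundedness_mirage_def by blast
  obtain w k where w: "is_omega N w" "mem N k w" "\<And>n. k \<noteq> num N n"
    using thinks_omega_illfounded_nonstandard[OF zfc[OF N(1)] K(2,3)] by metis
  have "dom M \<noteq> {}" using zfc[OF M] unfolding zfc_model_def is_struct_def by blast
  from represents_computably_saturated[OF zfc[OF N(1)] w N(2) this]
  show "zfc_model M \<and> computably_saturated M" using zfc[OF M] by blast
qed

end
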